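(* There exists a randomised algorithm that, given an undirected graph $G=(V,E)$ with minimum degree at least $3$ and a number $0<\varepsilon<1$, outputs a quantity that, with probability at least $3/4$, is an $\varepsilon$-approximation to the number of sink-free orientations of $G$. The running time is $O\big((n/\varepsilon)^2\log(n/\varepsilon)\big)$, where $n=|V|$ is the number of vertices of $G$.
   Context: Graphs are finite, undirected and not necessarily simple (parallel edges are allowed; each edge joins two distinct vertices). The input graph is given as an adjacency list in which the neighbours of each vertex are arbitrarily ordered. An orientation of $G$ assigns a direction to each edge. A vertex is a sink in an orientation if it has no outgoing edge. An orientation of $G$ is sink-free if every vertex has at least one outgoing edge. For a target quantity $Z>0$, an $\varepsilon$-approximation to $Z$ is a number $\widetilde Z$ with $1-\varepsilon\le \widetilde Z/Z\le 1+\varepsilon$. *)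

theory Defs
  imports "HOL-Probability.Probability"
begin

section \<open>Multigraphs and sink-free orientations\<close>

record ('v, 'e) multigraph =
  verts :: "'v set"
  edges :: "'e set"
  ends :: "'e \<Rightarrow> 'v set"

definition wf_multigraph :: "('v, 'e) multigraph \<Rightarrow> bool" where
  "wf_multigraph G \<longleftrightarrow> finite (verts G) \<and> finite (edges G) \<and>
     (\<forall>e\<in>edges G. ends G e \<subseteq> verts G \<and> card (ends G e) = 2)"

definition vertex_degree :: "('v, 'e) multigraph \<Rightarrow> 'v \<Rightarrow> nat" where
  "vertex_degree G v = card {e \<in> edges G. v \<in> ends G e}"

text \<open>An orientation maps each edge to its head.\<close>

definition orientations :: "('v, 'e) multigraph \<Rightarrow> ('e \<Rightarrow> 'v) set" where
  "orientations G = (\<Pi>\<^sub>E e\<in>edges G. ends G e)"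

definition outgoing :: "('v, 'e) multigraph \<Rightarrow> ('e \<Rightarrow> 'v) \<Rightarrow> 'v \<Rightarrow> 'e set" where
  "outgoing G \<sigma> v = {e \<in> edges G. v \<in> ends G e \<and> \<sigma> e \<noteq> v}"

definition is_sink :: "('v, 'e) multigraph \<Rightarrow> ('e \<Rightarrow> 'v) \<Rightarrow> 'v \<Rightarrow> bool" where
  "is_sink G \<sigma> v \<longleftrightarrow> outgoing G \<sigma> v = {}"

definition sink_free_orientations :: "('v, 'e) multigraph \<Rightarrow> ('e \<Rightarrow> 'v) set" where
  "sink_free_orientations G = {\<sigma> \<in> orientations G. \<forall>v\<in>verts G. \<not> is_sink G \<sigma> v}"

text \<open>An adjacency list gives, for each of the vertices \<open>0, \<dots>, n - 1\<close>, its neighbours in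
  arbitrary order, a neighbour being repeated once for each parallel edge. Entries carry no edge
  identifiers and no pointers to the matching entry of the other endpoint.\<close>

definition adjacency_list :: "(nat, 'e) multigraph \<Rightarrow> nat list list \<Rightarrow> bool" where
  "adjacency_list G L \<longleftrightarrow> verts G = {..<length L} \<and>
     (\<forall>u\<in>verts G. \<forall>v. count_list (L ! u) v = card {e \<in> edges G. ends G e = {u, v}})"

definition is_approximation :: "real \<Rightarrow> real \<Rightarrow> real \<Rightarrow> bool" where
  "is_approximation \<epsilon> Z Z' \<longleftrightarrow> 1 - \<epsilon> \<le> Z' / Z \<and> Z' / Z \<le> 1 + \<epsilon>"

section \<open>Randomised RAM programs\<close>

text \<open>
  The model is a RAM with integer registers, an indirectly addressed integer memory, random access
  to the adjacency list, and fair coin flips. Every command step costs one unit. The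
  expressions of a fixed program have bounded size, so charging for each operation separately would
  change running times only by a constant factor. Arithmetic itself does not limit the size
  of numbers; the word length is limited by the predicate \<open>uses_words_below\<close> below.

  The accuracy \<open>\<epsilon>\<close> is an arbitrary real number, which a discrete machine cannot hold in a
  register. It is accessible only through comparisons: \<open>EpsGreater a b\<close> tests whether
  \<open>\<epsilon> > a / b\<close> (for positive \<open>b\<close>). If \<open>\<epsilon>\<close> is rational and given by
  numerator and denominator, such a test is a constant number of arithmetic operations.\<close>

datatype expr =
    Num int
  | Reg nat
  | Load expr
  | VertexCount
  | Degree expr
  | Neighbour expr expr
  | EpsGreater expr expr
  | Plus expr expr
  | Minus expr expr
  | Times expr expr
  | Divide expr expr
  | Less expr expr

datatype com =
    Assign nat expr
  | Store expr expr
  | Flip nat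
  | Seq com com
  | Cond expr com com
  | While expr com

text \<open>Adjacency-list queries out of range return \<open>0\<close>.\<close>

primrec eval :: "nat list list \<Rightarrow> real \<Rightarrow> (nat \<Rightarrow> int) \<Rightarrow> (int \<Rightarrow> int) \<Rightarrow> expr \<Rightarrow> int" where
  "eval L \<epsilon> R M (Num i) = i"
| "eval L \<epsilon> R M (Reg r) = R r"
| "eval L \<epsilon> R M (Load a) = M (eval L \<epsilon> R M a)"
| "eval L \<epsilon> R M VertexCount = int (length L)"
| "eval L \<epsilon> R M (Degree a) =
     (let v = eval L \<epsilon> R M a in
      if 0 \<le> v \<and> v < int (length L) then int (length (L ! nat v)) else 0)"
| "eval L \<epsilon> R M (Neighbour a b) =
     (let v = eval L \<epsilon> R M a; i = eval L \<epsilon> R M b in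
      if 0 \<le> v \<and> v < int (length L) \<and> 0 \<le> i \<and> i < int (length (L ! nat v))
      then int (L ! nat v ! nat i) else 0)"
| "eval L \<epsilon> R M (EpsGreater a b) =
     of_bool (of_int (eval L \<epsilon> R M a) < \<epsilon> * of_int (eval L \<epsilon> R M b))"
| "eval L \<epsilon> R M (Plus a b) = eval L \<epsilon> R M a + eval L \<epsilon> R M b"
| "eval L \<epsilon> R M (Minus a b) = eval L \<epsilon> R M a - eval L \<epsilon> R M b"
| "eval L \<epsilon> R M (Times a b) = eval L \<epsilon> R M a * eval L \<epsilon> R M b"
| "eval L \<epsilon> R M (Divide a b) = eval L \<epsilon> R M a div eval L \<epsilon> R M b"
| "eval L \<epsilon> R M (Less a b) = of_bool (eval L \<epsilon> R M a < eval L \<epsilon> R M b)"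

text \<open>A configuration consists of the stack of commands still to be executed, the registers and
  the memory. Tests in \<open>Cond\<close> and \<open>While\<close> succeed on nonzero values.\<close>

type_synonym config = "com list \<times> (nat \<Rightarrow> int) \<times> (int \<Rightarrow> int)"

fun step :: "nat list list \<Rightarrow> real \<Rightarrow> config \<Rightarrow> config pmf" where
  "step L \<epsilon> ([], R, M) = return_pmf ([], R, M)"
| "step L \<epsilon> (Assign r a # cs, R, M) = return_pmf (cs, R(r := eval L \<epsilon> R M a), M)"
| "step L \<epsilon> (Store a b # cs, R, M) =
     return_pmf (cs, R, M(eval L \<epsilon> R M a := eval L \<epsilon> R M b))"
| "step L \<epsilon> (Flip r # cs, R, M) =
     map_pmf (\<lambda>b. (cs, R(r := of_bool b), M)) (bernoulli_pmf (1 / 2))"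
| "step L \<epsilon> (Seq c d # cs, R, M) = return_pmf (c # d # cs, R, M)"
| "step L \<epsilon> (Cond a c d # cs, R, M) =
     return_pmf ((if eval L \<epsilon> R M a \<noteq> 0 then c else d) # cs, R, M)"
| "step L \<epsilon> (While a c # cs, R, M) =
     return_pmf (if eval L \<epsilon> R M a \<noteq> 0 then c # While a c # cs else cs, R, M)"

primrec steps :: "nat list list \<Rightarrow> real \<Rightarrow> nat \<Rightarrow> config \<Rightarrow> config pmf" where
  "steps L \<epsilon> 0 s = return_pmf s"
| "steps L \<epsilon> (Suc t) s = bind_pmf (step L \<epsilon> s) (steps L \<epsilon> t)"

definition run :: "com \<Rightarrow> nat list list \<Rightarrow> real \<Rightarrow> nat \<Rightarrow> config pmf" where
  "run P L \<epsilon> t = steps L \<epsilon> t ([P], \<lambda>_. 0, \<lambda>_. 0)"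

definition halts_within :: "com \<Rightarrow> nat list list \<Rightarrow> real \<Rightarrow> nat \<Rightarrow> bool" where
  "halts_within P L \<epsilon> t \<longleftrightarrow> (\<forall>s\<in>set_pmf (run P L \<epsilon> t). fst s = [])"

definition uses_words_below :: "com \<Rightarrow> nat list list \<Rightarrow> real \<Rightarrow> real \<Rightarrow> bool" where
  "uses_words_below P L \<epsilon> B \<longleftrightarrow>
     (\<forall>t. \<forall>(cs, R, M)\<in>set_pmf (run P L \<epsilon> t).
        (\<forall>r. \<bar>of_int (R r)\<bar> \<le> B) \<and> (\<forall>a. \<bar>of_int (M a)\<bar> \<le> B))"

text \<open>The output is a floating-point number with mantissa in register \<open>0\<close> and exponent in
  register \<open>1\<close>: the number of sink-free orientations may be of order \<open>2 ^ m\<close>, where the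
  number \<open>m\<close> of edges is not bounded in terms of the number of vertices.\<close>

fun output_value :: "config \<Rightarrow> real" where
  "output_value (cs, R, M) = of_int (R 0) * 2 powi R 1"

end

theory Submission
  imports Defs
begin

text \<open>
  The algorithm needs no coins. For a set \<open>S\<close> of vertices let \<open>p S\<close> be the probability that a uniformly
  random orientation has no sink in \<open>S\<close>. As the neighbours of a sink are no sinks,
  \<open>p (S \<union> {v}) = p S - p (S - N v) / 2 ^ d\<close> with \<open>d = deg v\<close>. Hence the ratios
  \<open>r S v = p (S \<union> {v}) / p S\<close> satisfy \<open>r S v = 1 - (\<Prod>\<^sub>j 1 / r (S - {u\<^sub>1, \<dots>, u\<^sub>j}) u\<^sub>j) / 2 ^ d\<close>,
  where \<open>u\<^sub>1, u\<^sub>2, \<dots>\<close> are the neighbours of \<open>v\<close> in \<open>S\<close>, and the number of sink-free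
  orientations is \<open>2 ^ m\<close> times the product of \<open>n\<close> such ratios.

  Below the root of the recursion at most \<open>d - 1\<close> neighbours are left, all ratios are at least \<open>4 / 5\<close>,
  and in the potential \<open>ln (r - 2 / 3)\<close> an error \<open>E\<close> in every child causes an error of at most
  \<open>E / (d - 1)\<close> in the parent. So a work budget \<open>N\<close>, divided equally among the \<open>d - 1\<close> children and
  leading to the trivial estimate \<open>1\<close> once it is smaller than the degree, yields a ratio with error
  \<open>O(1 / N)\<close> in time \<open>O(N)\<close>. Taking \<open>N\<close> of order \<open>n / \<epsilon>\<close> for each of the \<open>n\<close> ratios, and fixed-point
  arithmetic with denominator \<open>N\<close>, gives the theorem.
\<close>

section \<open>Weakest preconditions with a clock\<close>

text \<open>The error \<open>O(1 / N)\<close> has to shrink by the same factor as the budget, which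
  is why a contraction by exactly \<open>1 / (d - 1)\<close>, summed over all children, is aimed at.
  The plain logarithm of the ratio does not give it: for \<open>d = 4\<close> and three children of
  ratio \<open>4 / 5\<close> its factor is \<open>375 / 899 > 1 / 3\<close>. Subtracting
  \<open>2 / 3\<close> makes the parent more sensitive, but a child at \<open>4 / 5\<close> now
  counts with weight \<open>1 / 6\<close> instead of 1, and the balance is favourable. The bound
  \<open>d - 1\<close> on the number of children comes from the parent, a list entry outside
  \<open>S\<close>. The number of edges is not bounded in terms of \<open>n\<close>, so a list
  longer than the budget must not be read at all; there the sink term is at most
  \<open>(5 / 8) ^ d\<close>, so that the estimate 1 is already good enough. Every child works on a
  set of its own, and copying sets would be too slow. One array of marks serves all frames, each
  frame restoring what it has removed.\<close>

locale machine =
  fixes L :: "nat list list" and \<epsilon> :: real and B :: int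
begin

definition words_le :: "(nat \<Rightarrow> int) \<Rightarrow> (int \<Rightarrow> int) \<Rightarrow> bool" where
  "words_le R M \<longleftrightarrow> (\<forall>r. \<bar>R r\<bar> \<le> B) \<and> (\<forall>a. \<bar>M a\<bar> \<le> B)"

text \<open>The point mass expresses determinism. The word bound is recorded at every intermediate
  time because \<open>uses_words_below\<close> constrains whole runs.\<close>

definition path :: "nat \<Rightarrow> config \<Rightarrow> config \<Rightarrow> bool" where
  "path k s s' \<longleftrightarrow> steps L \<epsilon> k s = return_pmf s' \<and>
     (\<forall>i\<le>k. \<forall>(cs, R, M)\<in>set_pmf (steps L \<epsilon> i s). words_le R M)"

text \<open>The bound on words is assumed of the initial state, so that a verification only has to bound
  newly written values; \<open>t\<close> is the time at which the execution of \<open>c\<close> starts.\<close>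

definition wp ::
  "com \<Rightarrow> ((nat \<Rightarrow> int) \<Rightarrow> (int \<Rightarrow> int) \<Rightarrow> nat \<Rightarrow> bool) \<Rightarrow> (nat \<Rightarrow> int) \<Rightarrow> (int \<Rightarrow> int) \<Rightarrow> nat \<Rightarrow> bool"
where
  "wp c \<Phi> R M t \<longleftrightarrow> (words_le R M \<longrightarrow>
     (\<exists>k R' M'. (\<forall>cs. path k (c # cs, R, M) (cs, R', M')) \<and> \<Phi> R' M' (t + k)))"

lemma steps_add: "steps L \<epsilon> (i + j) s = bind_pmf (steps L \<epsilon> i s) (steps L \<epsilon> j)"
proof (induction i arbitrary: s)
  case 0
  then show ?case by (simp add: bind_return_pmf)
next
  case (Suc i)
  have "steps L \<epsilon> (i + j) = (\<lambda>s. bind_pmf (steps L \<epsilon> i s) (steps L \<epsilon> j))" using Suc by auto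
  then show ?case by (simp add: bind_assoc_pmf)
qed

lemma path_append:
  assumes "path i s s'" "path j s' s''"
  shows "path (i + j) s s''"
  unfolding path_def
proof (intro conjI allI impI)
  show "steps L \<epsilon> (i + j) s = return_pmf s''"
    using assms by (simp add: path_def steps_add bind_return_pmf)
next
  fix k assume k: "k \<le> i + j"
  show "\<forall>(cs, R, M)\<in>set_pmf (steps L \<epsilon> k s). words_le R M"
  proof (cases "k \<le> i")
    case True
    then show ?thesis using assms by (auto simp: path_def)
  next
    case False
    then have "steps L \<epsilon> k s = steps L \<epsilon> (k - i) s'"
      using steps_add[of i "k - i" s] assms by (simp add: path_def bind_return_pmf)
    moreover have "k - i \<le> j" using k by simp
    ultimately show ?thesis using assms(2) unfolding path_def by metis
  qed
qed

lemma path_step: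
  assumes "words_le R M" "step L \<epsilon> (cs, R, M) = return_pmf (cs', R', M')" "words_le R' M'"
  shows "path 1 (cs, R, M) (cs', R', M')"
  using assms by (auto simp: path_def le_Suc_eq bind_return_pmf bind_return_pmf')

lemma path_words:
  "path k (cs, R, M) (cs', R', M') \<Longrightarrow> words_le R M"
  "path k (cs, R, M) (cs', R', M') \<Longrightarrow> words_le R' M'"
  by (auto simp: path_def)

lemma wp_step:
  assumes "\<And>cs. step L \<epsilon> (c # cs, R, M) = return_pmf (ds @ cs, R', M')"
    and "words_le R M \<Longrightarrow> words_le R' M'"
    and "words_le R' M' \<Longrightarrow>
      \<exists>k R'' M''. (\<forall>cs. path k (ds @ cs, R', M') (cs, R'', M'')) \<and> \<Phi> R'' M'' (Suc t + k)"
  shows "wp c \<Phi> R M t"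
  unfolding wp_def
proof
  assume w: "words_le R M"
  then obtain k R'' M'' where k: "\<And>cs. path k (ds @ cs, R', M') (cs, R'', M'')"
    and \<Phi>: "\<Phi> R'' M'' (Suc t + k)" using assms by blast
  have "path (1 + k) (c # cs, R, M) (cs, R'', M'')" for cs
    by (rule path_append[OF path_step[OF w assms(1) assms(2)[OF w]] k])
  then show "\<exists>k R' M'. (\<forall>cs. path k (c # cs, R, M) (cs, R', M')) \<and> \<Phi> R' M' (t + k)"
    using \<Phi> by (intro exI[of _ "1 + k"]) auto
qed

lemma path_0: "words_le R M \<Longrightarrow> path 0 (cs, R, M) (cs, R, M)"
  by (auto simp: path_def)

lemma wp_step_final:
  assumes "\<And>cs. step L \<epsilon> (c # cs, R, M) = return_pmf (cs, R', M')"
    and "words_le R M \<Longrightarrow> words_le R' M'" and "\<Phi> R' M' (Suc t)"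
  shows "wp c \<Phi> R M t"
proof (rule wp_step[where ds = "[]" and R' = R' and M' = M'])
  assume "words_le R' M'"
  then have "\<forall>cs. path 0 ([] @ cs, R', M') (cs, R', M')" by (simp add: path_0)
  then show "\<exists>k R'' M''. (\<forall>cs. path k ([] @ cs, R', M') (cs, R'', M'')) \<and> \<Phi> R'' M'' (Suc t + k)"
    using assms(3) by (metis add_0_right)
qed (use assms in auto)

lemma wp_Assign:
  assumes "\<Phi> (R(r := eval L \<epsilon> R M a)) M (Suc t)" "\<bar>eval L \<epsilon> R M a\<bar> \<le> B"
  shows "wp (Assign r a) \<Phi> R M t"
  by (rule wp_step_final[where R'="R(r := eval L \<epsilon> R M a)" and M'=M])
    (use assms in \<open>auto simp: words_le_def\<close>)

lemma wp_Store:
  assumes "\<Phi> R (M(eval L \<epsilon> R M a := eval L \<epsilon> R M b)) (Suc t)" "\<bar>eval L \<epsilon> R M b\<bar> \<le> B"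
  shows "wp (Store a b) \<Phi> R M t"
  by (rule wp_step_final[where R'=R and M'="M(eval L \<epsilon> R M a := eval L \<epsilon> R M b)"])
    (use assms in \<open>auto simp: words_le_def\<close>)

lemma wp_Cond:
  assumes "wp (if eval L \<epsilon> R M a \<noteq> 0 then c else d) \<Phi> R M (Suc t)"
  shows "wp (Cond a c d) \<Phi> R M t"
  by (rule wp_step[where ds="[if eval L \<epsilon> R M a \<noteq> 0 then c else d]" and R'=R and M'=M])
    (use assms in \<open>auto simp: wp_def\<close>)

lemma wp_sequential:
  assumes "wp c (wp d \<Phi>) R M t" "words_le R M"
  shows "\<exists>k R' M'. (\<forall>cs. path k (c # d # cs, R, M) (cs, R', M')) \<and> \<Phi> R' M' (t + k)"
proof -
  obtain i R1 M1 where i: "\<And>cs. path i (c # cs, R, M) (cs, R1, M1)" and 1: "wp d \<Phi> R1 M1 (t + i)"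
    using assms unfolding wp_def by blast
  have "words_le R1 M1" using i by (rule path_words)
  then obtain j R2 M2 where j: "\<And>cs. path j (d # cs, R1, M1) (cs, R2, M2)" and 2: "\<Phi> R2 M2 (t + i + j)"
    using 1 unfolding wp_def by blast
  show ?thesis using path_append[OF i j] 2
    by (intro exI[of _ "i + j"]) (auto simp: add.assoc)
qed

lemma wp_Seq:
  assumes "wp c (wp d \<Phi>) R M (Suc t)"
  shows "wp (Seq c d) \<Phi> R M t"
  by (rule wp_step[where ds="[c, d]" and R'=R and M'=M])
    (use wp_sequential[OF assms] in auto)

text \<open>A single unfolding, without invariant or variant: each loop is verified by an outer
  induction that carries the bound on the clock.\<close>

lemma wp_While:
  assumes "eval L \<epsilon> R M a \<noteq> 0 \<Longrightarrow> wp c (wp (While a c) \<Phi>) R M (Suc t)"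
    and "eval L \<epsilon> R M a = 0 \<Longrightarrow> \<Phi> R M (Suc t)"
  shows "wp (While a c) \<Phi> R M t"
proof (cases "eval L \<epsilon> R M a = 0")
  case True
  show ?thesis
    by (rule wp_step_final[where R'=R and M'=M]) (use assms(2) True in auto)
next
  case False
  show ?thesis
    by (rule wp_step[where ds="[c, While a c]" and R'=R and M'=M])
      (use wp_sequential[OF assms(1)] False in auto)
qed

lemmas wp_intros = wp_Seq wp_Assign wp_Store wp_Cond

end

section \<open>The program\<close>

text \<open>
  Registers: 0 and 1 hold mantissa and exponent of the product, 2 the scale of the fixed-point numbers
  (which is also the budget of a root), 3 the current root, 4 to 7 the vertex, the index
  into its list, the accumulated value and the budget of each child in the active frame, 8 the depth,
  9 a scratch value, 10 the last estimated ratio, 11 the sum of the degrees, and 12 is 1 while a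
  traversal is running.

  The frame of depth \<open>s\<close> is saved at the addresses \<open>4 s, \<dots>, 4 s + 3\<close>. Address \<open>- 1 - u\<close> holds 1 if the
  vertex \<open>u\<close> belongs to the current set \<open>S\<close>, and \<open>- 1 - s\<close> if the frame of depth \<open>s\<close> has
  removed it.
\<close>

abbreviation (input) mark_addr :: "expr \<Rightarrow> expr" where
  "mark_addr a \<equiv> Minus (Num (- 1)) a"

abbreviation (input) frame_addr :: "int \<Rightarrow> expr" where
  "frame_addr j \<equiv> Plus (Times (Num 4) (Reg 8)) (Num j)"

fun block :: "com list \<Rightarrow> com" where
  "block [] = Assign 9 (Num 0)"
| "block [c] = c"
| "block (c # cs) = Seq c (block cs)"

text \<open>The frame of depth \<open>s\<close> wrote \<open>- 1 - s\<close>, outer frames wrote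
  values of at least \<open>- s\<close>, and deeper frames have undone theirs. So the test
  \<open>< - s\<close> recognises the removals of the returning frame without a list of them being
  kept.\<close>

definition unmark_step :: com where
  "unmark_step = block
    [Assign 5 (Minus (Reg 5) (Num 1)),
     Assign 9 (Neighbour (Reg 4) (Reg 5)),
     Cond (Less (Load (mark_addr (Reg 9))) (Minus (Num 0) (Reg 8)))
       (Store (mark_addr (Reg 9)) (Num 1)) (block [])]"

definition unmark :: com where
  "unmark = While (Less (Num 0) (Reg 5)) unmark_step"

text \<open>Halving serves two cases: an entry outside \<open>S\<close>, and an entry with the
  trivial estimate, where \<open>x * Q div (2 * Q) = x div 2\<close>.\<close>

definition advance :: com where
  "advance = block
    [Assign 6 (Divide (Reg 6) (Num 2)),
     Assign 5 (Plus (Reg 5) (Num 1))]"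

text \<open>Register 4 is overwritten before register 7, so the degrees in the new budget are those
  of the child, while the old \<open>Reg 7\<close> is what the parent grants to it.\<close>

definition call :: com where
  "call = block
    [Store (frame_addr 0) (Reg 4),
     Store (frame_addr 1) (Reg 5),
     Store (frame_addr 2) (Reg 6),
     Store (frame_addr 3) (Reg 7),
     Assign 4 (Reg 9),
     Assign 5 (Num 0),
     Assign 6 (Reg 2),
     Assign 7 (Divide (Minus (Reg 7) (Degree (Reg 4))) (Minus (Degree (Reg 4)) (Num 1))),
     Assign 8 (Plus (Reg 8) (Num 1))]"

definition return :: com where
  "return = block
    [unmark,
     Assign 10 (Minus (Reg 2) (Reg 6)),
     Cond (Less (Num 0) (Reg 8))
       (block
         [Assign 8 (Minus (Reg 8) (Num 1)),
          Assign 4 (Load (frame_addr 0)),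
          Assign 5 (Plus (Load (frame_addr 1)) (Num 1)),
          Assign 6 (Divide (Times (Load (frame_addr 2)) (Reg 2)) (Times (Num 2) (Reg 10))),
          Assign 7 (Load (frame_addr 3))])
       (Assign 12 (Num 0))]"

definition visit :: com where
  "visit = Cond (Less (Reg 5) (Degree (Reg 4)))
    (block
      [Assign 9 (Neighbour (Reg 4) (Reg 5)),
       Cond (Less (Num 0) (Load (mark_addr (Reg 9))))
         (block
           [Store (mark_addr (Reg 9)) (Minus (Num (- 1)) (Reg 8)),
            Cond (Less (Reg 7) (Degree (Reg 9))) advance call])
         advance])
    return"

definition traverse :: com where
  "traverse = While (Reg 12) visit"

definition estimate_ratio :: com where
  "estimate_ratio = Cond (Less (Reg 2) (Degree (Reg 3)))
    (Assign 10 (Reg 2))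
    (block
      [Assign 4 (Reg 3),
       Assign 5 (Num 0),
       Assign 6 (Reg 2),
       Assign 7 (Divide (Minus (Reg 2) (Degree (Reg 3))) (Minus (Degree (Reg 3)) (Num 1))),
       Assign 8 (Num 0),
       Assign 12 (Num 1),
       traverse])"

text \<open>The factor 256 leaves room for \<open>n\<close> ratios with logarithmic error
  \<open>96 / Q\<close> each and a total of \<open>\<epsilon> / 2\<close>. Register 1 counts the
  doublings downwards, so that mantissa \<open>Q\<close> with this exponent denotes 1.\<close>

definition choose_precision :: com where
  "choose_precision = While (Less (EpsGreater (Times (Num 256) VertexCount) (Reg 2)) (Num 1))
    (block
      [Assign 2 (Times (Num 2) (Reg 2)),
       Assign 1 (Minus (Reg 1) (Num 1))])"

text \<open>A ratio of at least \<open>3 / 4\<close> cannot push a mantissa in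
  \<open>[Q, 2 * Q)\<close> below \<open>Q / 2\<close>, so one conditional doubling renormalises it.
  A root is marked only after its ratio is estimated; its set \<open>S\<close> thus consists of the
  smaller vertices.\<close>

definition multiply_ratios :: com where
  "multiply_ratios = While (Less (Reg 3) VertexCount)
    (block
      [estimate_ratio,
       Store (mark_addr (Reg 3)) (Num 1),
       Assign 11 (Plus (Reg 11) (Degree (Reg 3))),
       Assign 0 (Divide (Times (Reg 0) (Reg 10)) (Reg 2)),
       Cond (Less (Reg 0) (Reg 2))
         (block
           [Assign 0 (Times (Num 2) (Reg 0)),
            Assign 1 (Minus (Reg 1) (Num 1))])
         (block []),
       Assign 3 (Plus (Reg 3) (Num 1))])"

text \<open>Half of the degree sum is the number of edges; adding it to the exponent turns a
  probability into a number of orientations.\<close>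

definition count_program :: com where
  "count_program = block
    [Assign 2 (Num 1),
     choose_precision,
     Assign 0 (Reg 2),
     multiply_ratios,
     Assign 1 (Plus (Reg 1) (Divide (Reg 11) (Num 2)))]"

section \<open>Scanning neighbour lists in fixed-point arithmetic\<close>

locale neighbour_lists =
  fixes L :: "nat list list" and Q :: int
  assumes degree_ge_3: "v < length L \<Longrightarrow> 3 \<le> length (L ! v)"
    and neighbour_sym: "v < length L \<Longrightarrow> u \<in> set (L ! v) \<Longrightarrow> u < length L \<and> v \<in> set (L ! u)"
    and Q_pos: "0 < Q"
begin

text \<open>In fixed-point arithmetic with denominator \<open>Q\<close>, \<open>scan N S us x\<close> divides \<open>x\<close> by 2 for every entry of
  \<open>us\<close> and by the estimated ratio of every entry that is still in \<open>S\<close> when it is met. The test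
  \<open>d = 0\<close> only serves termination.\<close>

function scan :: "nat \<Rightarrow> nat set \<Rightarrow> nat list \<Rightarrow> int \<Rightarrow> int" where
  "scan N S [] x = x"
| "scan N S (u # us) x =
     (if u \<in> S then
        (let d = length (L ! u);
             r = (if N < d \<or> d = 0 then Q else Q - scan ((N - d) div (d - 1)) (S - {u}) (L ! u) Q)
         in scan N (S - {u}) us (x * Q div (2 * r)))
      else scan N S us (x div 2))"
  by pat_completeness auto
termination
proof (relation "measures [\<lambda>(N, S, us, x). N, \<lambda>(N, S, us, x). length us]")
  fix N S u and us :: "nat list" and x :: int and d
  assume d: "d = length (L ! u)" "\<not> (N < d \<or> d = 0)"
  have "(N - d) div (d - 1) \<le> N - d" by simp
  also have "\<dots> < N" using d by linarith
  finally show "(((N - d) div (d - 1), S - {u}, L ! u, Q), N, S, u # us, x)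
      \<in> measures [\<lambda>(N, S, us, x). N, \<lambda>(N, S, us, x). length us]"
    by simp
qed auto

text \<open>The \<open>d\<close> units withheld from the children pay for the list of \<open>u\<close> itself, yet for
  \<open>d \<ge> 3\<close> a child's budget \<open>N'\<close> still satisfies \<open>(N' + 4) * (d - 1) \<ge> N + 4\<close>.\<close>

definition child_budget :: "nat \<Rightarrow> nat \<Rightarrow> nat" where
  "child_budget N u = (N - length (L ! u)) div (length (L ! u) - 1)"

definition ratio_estimate :: "nat \<Rightarrow> nat set \<Rightarrow> nat \<Rightarrow> int" where
  "ratio_estimate N S u =
     (if N < length (L ! u) then Q else Q - scan (child_budget N u) S (L ! u) Q)"

lemma scan_Cons:
  assumes "u < length L"
  shows "scan N S (u # us) x = (if u \<in> S
    then scan N (S - {u}) us (x * Q div (2 * ratio_estimate N (S - {u}) u))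
    else scan N S us (x div 2))"
  using degree_ge_3[OF assms] by (auto simp: ratio_estimate_def child_budget_def Let_def)

declare scan.simps(2) [simp del]

lemma child_budget_less:
  assumes "u < length L" "length (L ! u) \<le> N"
  shows "child_budget N u < N"
proof -
  have "child_budget N u \<le> N - length (L ! u)" by (simp add: child_budget_def)
  also have "\<dots> < N" using degree_ge_3[OF assms(1)] assms(2) by linarith
  finally show ?thesis .
qed

lemma child_budget_mult: "child_budget N u * (length (L ! u) - 1) \<le> N - length (L ! u)"
  by (simp add: child_budget_def)

text \<open>Meant for the list \<open>us\<close> of a child whose parent \<open>v\<close> has left
  \<open>S\<close>: the parent occupies an entry, which leaves at most \<open>d - 1\<close>
  grandchildren.\<close>

lemma card_neighbours_less:
  assumes "v \<in> set us" "v \<notin> S"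
  shows "card (S \<inter> set us) \<le> length us - 1"
proof -
  have "card (S \<inter> set us) \<le> card (set us - {v})" using assms by (intro card_mono) auto
  also have "\<dots> = card (set us) - 1" using assms by simp
  also have "\<dots> \<le> length us - 1" using card_length[of us] by simp
  finally show ?thesis .
qed

text \<open>The worst case is \<open>d = 3\<close>, \<open>k = 2\<close> with value
  \<open>25 / 128\<close>. Since \<open>5 / 4\<close> is the inverse of \<open>1 - 1 / 5\<close>,
  the lower bound \<open>4 / 5\<close> on ratios reproduces itself.\<close>

lemma power_five_eighths_le:
  assumes "3 \<le> d" "k \<le> d - 1"
  shows "(1 / 2 :: real) ^ d * (5 / 4) ^ k \<le> 1 / 5"
proof -
  have "(1 / 2 :: real) ^ d * (5 / 4) ^ k \<le> (1 / 2) ^ d * (5 / 4) ^ (d - 1)"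
    using assms by (intro mult_left_mono power_increasing) auto
  also have "\<dots> = 1 / 2 * (5 / 8) ^ (d - 1)"
    using assms by (cases d) (auto simp: power_mult_distrib[symmetric])
  also have "\<dots> \<le> 1 / 2 * (5 / 8) ^ 2"
    using assms by (intro mult_left_mono power_decreasing) auto
  also have "\<dots> \<le> 1 / 5" by (simp add: power2_eq_square)
  finally show ?thesis .
qed

text \<open>Rounding down only lowers the value, so the bound of exact arithmetic survives. The
  outer induction is on the budget, as the ratio of a child is bounded through the claim for a
  smaller budget; the inner one runs along the list.\<close>

lemma scan_bounds:
  assumes "v < length L" "v \<notin> S" "set us \<subseteq> set (L ! v)" "0 \<le> x"
  shows "0 \<le> scan N S us x \<and>
    scan N S us x \<le> x * (1 / 2) ^ length us * (5 / 4) ^ card (S \<inter> set us)"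
  using assms
proof (induction N arbitrary: v S us x rule: less_induct)
  case (less N)
  have estimate: "4 * Q \<le> 5 * ratio_estimate N S u \<and> ratio_estimate N S u \<le> Q"
    if u: "u < length L" "v \<in> set (L ! u)" "v \<notin> S" "u \<notin> S" for u v S
  proof (cases "N < length (L ! u)")
    case False
    define z where "z = scan (child_budget N u) S (L ! u) Q"
    have z: "0 \<le> z" "z \<le> Q * (1 / 2) ^ length (L ! u) * (5 / 4) ^ card (S \<inter> set (L ! u))"
      using less.IH[OF child_budget_less, of u u S "L ! u" Q] u False Q_pos by (auto simp: z_def)
    have "Q * ((1 / 2) ^ length (L ! u) * (5 / 4) ^ card (S \<inter> set (L ! u))) \<le> Q * (1 / 5 :: real)"
      using u Q_pos by (intro mult_left_mono power_five_eighths_le degree_ge_3 card_neighbours_less) auto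
    then have "5 * z \<le> Q" using z(2) by (simp add: mult.assoc)
    then show ?thesis using False z(1) by (simp add: ratio_estimate_def z_def)
  qed (use Q_pos in \<open>simp add: ratio_estimate_def\<close>)
  show ?case using less.prems
  proof (induction us arbitrary: S x)
    case (Cons u us)
    have u: "u < length L" "v \<in> set (L ! u)" using neighbour_sym[of v u] Cons.prems by auto
    show ?case
    proof (cases "u \<in> S")
      case True
      define r where "r = ratio_estimate N (S - {u}) u"
      have r: "4 * Q \<le> 5 * r" using estimate[of u v "S - {u}"] u Cons.prems by (auto simp: r_def)
      define x' where "x' = x * Q div (2 * r)"
      have x': "0 \<le> x'" using Cons.prems r Q_pos by (auto simp: x'_def pos_imp_zdiv_nonneg_iff)
      have "real_of_int x' \<le> real_of_int (x * Q) / real_of_int (2 * r)"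
        unfolding x'_def by (rule real_of_int_div4)
      also have "\<dots> \<le> real_of_int (x * Q) / (8 / 5 * real_of_int Q)"
        using r Q_pos Cons.prems by (intro divide_left_mono) auto
      also have "\<dots> = x * (1 / 2 * (5 / 4))" using Q_pos by simp
      finally have x'_le: "real_of_int x' \<le> x * (1 / 2 * (5 / 4))" .
      have card: "card (S \<inter> set (u # us)) = Suc (card ((S - {u}) \<inter> set us))"
      proof -
        have "S \<inter> set (u # us) = insert u ((S - {u}) \<inter> set us)" using True by auto
        then show ?thesis by simp
      qed
      have IH: "0 \<le> scan N (S - {u}) us x'"
        "scan N (S - {u}) us x' \<le> x' * ((1 / 2) ^ length us * (5 / 4) ^ card ((S - {u}) \<inter> set us))"
        using Cons.IH[of "S - {u}" x'] Cons.prems x' by (auto simp: mult.assoc)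
      note IH(2)
      also have "x' * ((1 / 2) ^ length us * (5 / 4) ^ card ((S - {u}) \<inter> set us))
          \<le> x * (1 / 2 * (5 / 4)) * ((1 / 2) ^ length us * (5 / 4) ^ card ((S - {u}) \<inter> set us))"
        by (intro mult_right_mono x'_le) auto
      finally show ?thesis using IH(1) True card scan_Cons[OF u(1)] by (simp add: x'_def r_def mult_ac)
    next
      case False
      have card: "S \<inter> set (u # us) = S \<inter> set us" using False by auto
      have IH: "0 \<le> scan N S us (x div 2)"
        "scan N S us (x div 2) \<le> real_of_int (x div 2) * ((1 / 2) ^ length us * (5 / 4) ^ card (S \<inter> set us))"
        using Cons.IH[of S "x div 2"] Cons.prems by (auto simp: mult.assoc)
      note IH(2)
      also have "real_of_int (x div 2) * ((1 / 2) ^ length us * (5 / 4) ^ card (S \<inter> set us))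
          \<le> x / 2 * ((1 / 2) ^ length us * (5 / 4) ^ card (S \<inter> set us))"
        using real_of_int_div4[of x 2] by (intro mult_right_mono) auto
      finally show ?thesis using IH(1) False card scan_Cons[OF u(1)] by (simp add: mult_ac)
    qed
  qed auto
qed

lemma ratio_estimate_bounds:
  assumes "u < length L" "v \<in> set (L ! u)" "v \<notin> S" "u \<notin> S"
  shows "4 * Q \<le> 5 * ratio_estimate N S u" "ratio_estimate N S u \<le> Q"
proof -
  define z where "z = scan (child_budget N u) S (L ! u) Q"
  have z: "0 \<le> z" "z \<le> Q * (1 / 2) ^ length (L ! u) * (5 / 4) ^ card (S \<inter> set (L ! u))"
    using scan_bounds[of u S "L ! u" Q] assms Q_pos by (auto simp: z_def)
  have "Q * ((1 / 2) ^ length (L ! u) * (5 / 4) ^ card (S \<inter> set (L ! u))) \<le> Q * (1 / 5 :: real)"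
    using assms Q_pos by (intro mult_left_mono power_five_eighths_le degree_ge_3 card_neighbours_less) auto
  then have "5 * z \<le> Q" using z(2) by (simp add: mult.assoc)
  then show "4 * Q \<le> 5 * ratio_estimate N S u" "ratio_estimate N S u \<le> Q"
    using z(1) Q_pos by (auto simp: ratio_estimate_def z_def)
qed

end

section \<open>Correctness and running time of the program\<close>

text \<open>The bound \<open>2 * Q + 2\<close> covers the mantissa, which is below
  \<open>2 * Q\<close>, and also depths and marks, which stay within \<open>Q + 1\<close>.\<close>

locale traversal = machine L \<epsilon> B + neighbour_lists L Q for L \<epsilon> B Q +
  assumes size_le_B: "int (length L) \<le> B" and Q_le_B: "2 * Q + 2 \<le> B"
begin

lemma wp_unmark:
  assumes "R 5 = int i" "i \<le> length (L ! v)" "R 4 = int v" "v < length L" "R 8 = int s" "int i \<le> Q"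
    and "\<And>R' M' t'. (\<forall>r. r \<noteq> 5 \<and> r \<noteq> 9 \<longrightarrow> R' r = R r) \<Longrightarrow>
      (\<forall>w<length L. M' (- 1 - int w) =
         (if w \<in> set (take i (L ! v)) \<and> M (- 1 - int w) < - int s then 1 else M (- 1 - int w))) \<Longrightarrow>
      (\<forall>a\<ge>0. M' a = M a) \<Longrightarrow> t' \<le> t + 8 * i + 1 \<Longrightarrow> \<Phi> R' M' t'"
  shows "wp unmark \<Phi> R M t"
  using assms
proof (induction i arbitrary: R M t)
  case 0
  show ?case unfolding unmark_def
    by (rule wp_While) (use 0 in auto)
next
  case (Suc i)
  define u where "u = L ! v ! i"
  have u: "u \<in> set (L ! v)" "u < length L" using Suc.prems neighbour_sym[of v u] by (auto simp: u_def)
  have take: "set (take (Suc i) (L ! v)) = insert u (set (take i (L ! v)))"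
    using Suc.prems by (simp add: take_Suc_conv_app_nth u_def)
  define M1 where "M1 = (if M (- 1 - int u) < - int s then M(- 1 - int u := 1) else M)"
  have IH: "wp unmark \<Phi> R1 M1 t1"
    if "R1 5 = int i" "\<forall>r. r \<noteq> 5 \<and> r \<noteq> 9 \<longrightarrow> R1 r = R r" "t1 \<le> t + 8" for R1 t1
  proof (rule Suc.IH)
    fix R' M' t'
    assume *: "\<forall>r. r \<noteq> 5 \<and> r \<noteq> 9 \<longrightarrow> R' r = R1 r"
      "\<forall>w<length L. M' (- 1 - int w) =
         (if w \<in> set (take i (L ! v)) \<and> M1 (- 1 - int w) < - int s then 1 else M1 (- 1 - int w))"
      "\<forall>a\<ge>0. M' a = M1 a" "t' \<le> t1 + 8 * i + 1"
    show "\<Phi> R' M' t'"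
      by (rule Suc.prems(7)) (use * that in \<open>auto simp: M1_def take\<close>)
  qed (use Suc.prems that in auto)
  show ?case
    unfolding unmark_def
    apply (rule wp_While)
     apply (fold unmark_def)
     apply (simp only: unmark_step_def block.simps)
     apply (rule wp_intros)+
    using Suc.prems u size_le_B Q_le_B
    apply (simp_all add: u_def[symmetric])
    apply (intro conjI impI; rule wp_intros)
    using IH[of "R(5 := int i, 9 := int u)"] IH[of "R(5 := int i, 9 := 0)"] 
    apply (simp_all add: M1_def)
    done
qed

lemma wp_return:
  assumes "R 4 = int u" "u < length L" "R 5 = int (length (L ! u))" "int (length (L ! u)) \<le> Q"
    and "R 2 = Q" "R 8 = int (Suc s)" "int s \<le> Q" "R 6 = x" "0 \<le> x" "5 * x \<le> Q"
    and "M (4 * int s) = int v" "v < length L" "M (4 * int s + 1) = int i" "int i + 1 \<le> Q"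
    and "M (4 * int s + 2) = y" "0 \<le> y" "y \<le> Q" "M (4 * int s + 3) = int N" "int N \<le> Q"
    and "\<And>R' M' t'. R' 4 = int v \<Longrightarrow> R' 5 = int i + 1 \<Longrightarrow> R' 6 = y * Q div (2 * (Q - x)) \<Longrightarrow>
      R' 7 = int N \<Longrightarrow> R' 8 = int s \<Longrightarrow> (\<forall>r. r < 4 \<or> 10 < r \<longrightarrow> R' r = R r) \<Longrightarrow>
      (\<forall>w<length L. M' (- 1 - int w) =
         (if w \<in> set (L ! u) \<and> M (- 1 - int w) < - int (Suc s) then 1 else M (- 1 - int w))) \<Longrightarrow>
      (\<forall>a\<ge>0. M' a = M a) \<Longrightarrow> t' \<le> t + 8 * length (L ! u) + 20 \<Longrightarrow> \<Phi> R' M' t'"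
  shows "wp return \<Phi> R M t"
  unfolding return_def block.simps
proof (rule wp_Seq, rule wp_unmark)
  fix R' M' t'
  assume R': "\<forall>r. r \<noteq> 5 \<and> r \<noteq> 9 \<longrightarrow> R' r = R r"
    and M': "\<forall>w<length L. M' (- 1 - int w) = (if w \<in> set (take (length (L ! u)) (L ! u)) \<and>
      M (- 1 - int w) < - int (Suc s) then 1 else M (- 1 - int w))" "\<forall>a\<ge>0. M' a = M a"
    and t': "t' \<le> Suc t + 8 * length (L ! u) + 1"
  \<comment> \<open>By \<open>5 * x \<le> Q\<close> the divisor is at least \<open>Q\<close>, so the
    accumulated value never grows.\<close>
  have "y * Q div (2 * (Q - x)) \<le> y * Q div Q"
    using assms Q_pos by (intro zdiv_mono2) auto
  then have "y * Q div (2 * (Q - x)) \<le> B" "0 \<le> y * Q div (2 * (Q - x))"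
    using assms Q_pos Q_le_B by (auto intro!: div_int_pos_iff[THEN iffD2])
  then show "wp (Seq (Assign 10 (Minus (Reg 2) (Reg 6))) (Cond (Less (Num 0) (Reg 8))
      (Seq (Assign 8 (Minus (Reg 8) (Num 1)))
        (Seq (Assign 4 (Load (frame_addr 0)))
          (Seq (Assign 5 (Plus (Load (frame_addr 1)) (Num 1)))
            (Seq (Assign 6 (Divide (Times (Load (frame_addr 2)) (Reg 2)) (Times (Num 2) (Reg 10))))
              (Assign 7 (Load (frame_addr 3)))))))
      (Assign 12 (Num 0)))) \<Phi> R' M' t'"
    apply -
    apply (rule wp_intros)+
     apply (use assms(1-19) R' M' size_le_B Q_le_B in simp_all)
    apply (rule wp_intros)+
     apply (rule assms(20))
    apply (use assms(1-19) R' M' t' size_le_B Q_le_B in simp_all)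
    done
qed (use assms in auto)

text \<open>A mark outside \<open>S\<close> is 0 or was written at a depth below \<open>s\<close>;
  recording the resulting range is enough for the test in \<open>unmark\<close>.\<close>

definition marked :: "(int \<Rightarrow> int) \<Rightarrow> nat set \<Rightarrow> nat \<Rightarrow> bool" where
  "marked M S s \<longleftrightarrow> (\<forall>w<length L.
     if w \<in> S then M (- 1 - int w) = 1 else - int s \<le> M (- 1 - int w) \<and> M (- 1 - int w) \<le> 0)"

lemma int_child_budget:
  assumes "u < length L" "length (L ! u) \<le> N"
  shows "(int N - int (length (L ! u))) div (int (length (L ! u)) - 1) = int (child_budget N u)"
  using assms degree_ge_3[OF assms(1)] by (simp add: child_budget_def zdiv_int of_nat_diff)

text \<open>All frames share one loop, hence the loop itself is the continuation: the lemma leads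
  from entry \<open>i\<close> of a frame to the end of its list. An entry costs 30, and a member of
  \<open>S\<close> another \<open>50 * N\<close> for its subtree. Budgets fall strictly from frame
  to frame, which preserves \<open>s + N \<le> Q\<close> and so bounds the depth. Memory below
  \<open>4 * s\<close> belongs to the outer frames.\<close>

lemma wp_traverse:
  assumes "drop i (L ! v) = us" "i \<le> length (L ! v)" "v < length L" "v \<notin> S"
    and "int (length (L ! v)) \<le> Q" "int (s + N) \<le> Q"
    and "R 2 = Q" "R 12 = 1" "R 4 = int v" "R 5 = int i" "R 6 = x" "0 \<le> x" "x \<le> Q"
    and "R 7 = int N" "R 8 = int s" "marked M S (Suc s)"
    and "\<And>R' M' t'. R' 4 = int v \<Longrightarrow> R' 5 = int (length (L ! v)) \<Longrightarrow> R' 6 = scan N S us x \<Longrightarrow>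
      R' 7 = int N \<Longrightarrow> R' 8 = int s \<Longrightarrow> (\<forall>r. r < 4 \<or> 10 < r \<longrightarrow> R' r = R r) \<Longrightarrow>
      (\<forall>w<length L. M' (- 1 - int w) = (if w \<in> S \<inter> set us then - 1 - int s else M (- 1 - int w))) \<Longrightarrow>
      (\<forall>a. 0 \<le> a \<and> a < 4 * int s \<longrightarrow> M' a = M a) \<Longrightarrow>
      t' \<le> t + 30 * length us + 50 * N * card (S \<inter> set us) \<Longrightarrow> wp traverse \<Phi> R' M' t'"
  shows "wp traverse \<Phi> R M t"
  using assms
proof (induction N arbitrary: v S us i x s R M t rule: less_induct)
  case (less N)
  show ?case using less.prems
  proof (induction us arbitrary: S i x R M t)
    case Nil
    show ?case
      by (rule Nil.prems(17)) (use Nil.prems in auto)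
  next
    case (Cons u us)
    note prems = Cons.prems(1-16)
    have i: "i < length (L ! v)" using prems(1) by (cases "i < length (L ! v)") auto
    have u_eq: "L ! v ! i = u" and drop: "drop (Suc i) (L ! v) = us"
      using prems(1) Cons_nth_drop_Suc[OF i] by auto
    have u: "u < length L" "v \<in> set (L ! u)" using neighbour_sym[of v u] i prems(3) u_eq by auto
    \<comment> \<open>All cases end by passing to entry \<open>i + 1\<close>; writing
      \<open>S - {u}\<close> even when \<open>u\<close> is outside \<open>S\<close> unifies
      them.\<close>
    have next_entry: "wp traverse \<Phi> R1 M1 t1"
      if "\<forall>r. r < 4 \<or> 10 < r \<longrightarrow> R1 r = R r" "R1 4 = int v" "R1 5 = int i + 1" "R1 6 = x1"
        "0 \<le> x1" "x1 \<le> Q" "R1 7 = int N" "R1 8 = int s"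
        "\<forall>w<length L. M1 (- 1 - int w) = (if w \<in> S \<and> w = u then - 1 - int s else M (- 1 - int w))"
        "\<forall>a. 0 \<le> a \<and> a < 4 * int s \<longrightarrow> M1 a = M a"
        "t1 \<le> t + 30 + (if u \<in> S then 50 * N else 0)"
        "scan N S (u # us) x = scan N (S - {u}) us x1"
      for R1 M1 t1 x1
    proof (rule Cons.IH)
      show "marked M1 (S - {u}) (Suc s)"
        using that(9) prems(16) by (auto simp: marked_def)
      have card: "card (S \<inter> set (u # us)) = (if u \<in> S then 1 else 0) + card ((S - {u}) \<inter> set us)"
      proof -
        have "S \<inter> set (u # us) = (if u \<in> S then insert u ((S - {u}) \<inter> set us) else (S - {u}) \<inter> set us)" by auto
        then show ?thesis by simp
      qed
      fix R' M' t'
      assume *: "R' 4 = int v" "R' 5 = int (length (L ! v))" "R' 6 = scan N (S - {u}) us x1"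
        "R' 7 = int N" "R' 8 = int s" "\<forall>r. r < 4 \<or> 10 < r \<longrightarrow> R' r = R1 r"
        "\<forall>w<length L. M' (- 1 - int w) =
           (if w \<in> (S - {u}) \<inter> set us then - 1 - int s else M1 (- 1 - int w))"
        "\<forall>a. 0 \<le> a \<and> a < 4 * int s \<longrightarrow> M' a = M1 a"
        "t' \<le> t1 + 30 * length us + 50 * N * card ((S - {u}) \<inter> set us)"
      show "wp traverse \<Phi> R' M' t'"
      proof (rule Cons.prems(17))
        show "t' \<le> t + 30 * length (u # us) + 50 * N * card (S \<inter> set (u # us))"
          using *(9) that(11) unfolding card by (auto simp: algebra_simps split: if_splits)
      qed (use * that in auto)
    qed (use prems i drop that in auto)
    show ?case
    proof (cases "u \<in> S")
      case False
      have "scan N S (u # us) x = scan N (S - {u}) us (x div 2)" using False u by (simp add: scan_Cons)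
      moreover have "M (- 1 - int u) \<le> 0" using prems(16) u False by (simp add: marked_def)
      ultimately show ?thesis
        unfolding traverse_def
        apply -
        apply (rule wp_While)
         apply (fold traverse_def)
         apply (simp only: visit_def advance_def block.simps)
         apply (rule wp_intros)+
         apply (use prems i u size_le_B Q_le_B in \<open>simp_all add: u_eq\<close>)
        apply (rule wp_intros)+
          apply (use prems i u size_le_B Q_le_B in \<open>simp_all add: u_eq\<close>)
        apply (rule wp_intros)+
          apply (rule next_entry)
        apply (use False prems i u size_le_B Q_le_B in \<open>simp_all add: u_eq\<close>)
        done
    next
      case True
      define x1 where "x1 = x * Q div (2 * ratio_estimate N (S - {u}) u)"
      have scan: "scan N S (u # us) x = scan N (S - {u}) us x1" using True u by (simp add: scan_Cons x1_def)
      have mark: "M (- 1 - int u) = 1" using prems(16) u True by (simp add: marked_def)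
      show ?thesis
      proof (cases "N < length (L ! u)")
        case leaf: True
        have "x1 = x div 2" using leaf Q_pos by (simp add: x1_def ratio_estimate_def)
        then show ?thesis
          unfolding traverse_def
          apply -
          apply (rule wp_While)
           apply (fold traverse_def)
           apply (simp only: visit_def block.simps)
           apply (rule wp_intros)+
           apply (use prems i u size_le_B Q_le_B in \<open>simp_all add: u_eq\<close>)
          apply (rule wp_intros)+
            apply (use prems i u size_le_B Q_le_B mark in \<open>simp_all add: u_eq\<close>)
          apply (rule wp_intros)+
            apply (use leaf prems i u size_le_B Q_le_B in \<open>simp_all add: u_eq\<close>)
          apply (simp only: advance_def block.simps)
          apply (rule wp_intros)+
            apply (rule next_entry)
          apply (use True scan leaf prems i u size_le_B Q_le_B in \<open>simp_all add: u_eq\<close>)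
          done
      next
        case inner: False
        define N' where "N' = child_budget N u"
        define z where "z = scan N' (S - {u}) (L ! u) Q"
        have N': "N' < N" using inner u by (auto simp: N'_def intro!: child_budget_less)
        have z: "ratio_estimate N (S - {u}) u = Q - z" using inner by (simp add: ratio_estimate_def N'_def z_def)
        have "0 \<le> z" using scan_bounds[of u "S - {u}" "L ! u" Q] u Q_pos by (simp add: z_def)
        moreover have "5 * z \<le> Q"
          using ratio_estimate_bounds[of u v "S - {u}" N] u prems(4) by (simp add: z)
        ultimately have z_bounds: "0 \<le> z" "5 * z \<le> Q" .
        have card: "card ((S - {u}) \<inter> set (L ! u)) \<le> length (L ! u) - 1"
          using u prems(4) by (intro card_neighbours_less[of v]) auto
        have "N' * card ((S - {u}) \<inter> set (L ! u)) \<le> N - length (L ! u)"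
          using mult_le_mono2[OF card, of N'] child_budget_mult[of N u] unfolding N'_def by (rule order_trans)
        \<comment> \<open>Of the \<open>38\<close> per entry, 30 are for the scan of the child's
          list and 8 for unmarking. The subtrees cost at most \<open>50 * (N - d)\<close>, so the
          withheld \<open>50 * d\<close> pay for these \<open>38 * d\<close> and for the fixed
          overhead.\<close>
        then have time: "38 * length (L ! u) + 18 + 50 * N' * card ((S - {u}) \<inter> set (L ! u)) \<le> 50 * N"
          using degree_ge_3[OF u(1)] inner by linarith
        have descend: "wp traverse \<Phi> R1 M1 t1"
          if R1: "\<forall>r. r < 4 \<or> 10 < r \<longrightarrow> R1 r = R r" "R1 4 = int u" "R1 5 = 0" "R1 6 = Q"
            "R1 7 = int N'" "R1 8 = int s + 1"
          and M1: "\<forall>w<length L. M1 (- 1 - int w) = (if w = u then - 1 - int s else M (- 1 - int w))"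
            "\<forall>a. 0 \<le> a \<and> a < 4 * int s \<longrightarrow> M1 a = M a"
            "M1 (4 * int s) = int v" "M1 (4 * int s + 1) = int i" "M1 (4 * int s + 2) = x"
            "M1 (4 * int s + 3) = int N"
          and t1: "t1 \<le> t + 25"
          for R1 M1 t1
        proof (rule less.IH[OF N', where v=u and S="S - {u}" and i=0 and x=Q and s="Suc s"])
          show "marked M1 (S - {u}) (Suc (Suc s))"
            using M1(1) prems(16) by (auto simp: marked_def)
          fix R2 M2 t2
          assume R2: "R2 4 = int u" "R2 5 = int (length (L ! u))" "R2 6 = scan N' (S - {u}) (L ! u) Q"
            "R2 7 = int N'" "R2 8 = int (Suc s)" "\<forall>r. r < 4 \<or> 10 < r \<longrightarrow> R2 r = R1 r"
            and M2: "\<forall>w<length L. M2 (- 1 - int w) =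
              (if w \<in> (S - {u}) \<inter> set (L ! u) then - 1 - int (Suc s) else M1 (- 1 - int w))"
              "\<forall>a. 0 \<le> a \<and> a < 4 * int (Suc s) \<longrightarrow> M2 a = M1 a"
            and t2: "t2 \<le> t1 + 30 * length (L ! u) + 50 * N' * card ((S - {u}) \<inter> set (L ! u))"
          have ret: "wp return (wp traverse \<Phi>) R2 M2 t3" if t3: "t3 \<le> t2 + 3" for t3
          proof (rule wp_return)
            fix R3 M3 t4
            assume R3: "R3 4 = int v" "R3 5 = int i + 1" "R3 6 = x * Q div (2 * (Q - z))"
              "R3 7 = int N" "R3 8 = int s" "\<forall>r. r < 4 \<or> 10 < r \<longrightarrow> R3 r = R2 r"
              and M3: "\<forall>w<length L. M3 (- 1 - int w) =
                (if w \<in> set (L ! u) \<and> M2 (- 1 - int w) < - int (Suc s) then 1 else M2 (- 1 - int w))"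
                "\<forall>a\<ge>0. M3 a = M2 a"
              and t4: "t4 \<le> t3 + 8 * length (L ! u) + 20"
            show "wp traverse \<Phi> R3 M3 t4"
            proof (rule next_entry)
              show "R3 6 = x1" using R3 by (simp add: x1_def z)
              have "x * Q div (2 * (Q - z)) \<le> x * Q div Q"
                using z_bounds prems Q_pos by (intro zdiv_mono2) auto
              then show "x1 \<le> Q" using prems Q_pos by (simp add: x1_def z)
              show "0 \<le> x1" using prems Q_pos z_bounds
                by (auto simp: x1_def z intro!: div_int_pos_iff[THEN iffD2])
              \<comment> \<open>The returning child has depth \<open>s + 1\<close> and restores
                marks below \<open>- s - 1\<close>. The mark \<open>- 1 - s\<close> of
                \<open>u\<close> itself just escapes this test and stays until the parent
                returns.\<close>
              show "\<forall>w<length L. M3 (- 1 - int w) = (if w \<in> S \<and> w = u then - 1 - int s else M (- 1 - int w))"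
                using M3(1) M2(1) M1(1) prems(16) True by (auto simp: marked_def)
              show "\<forall>a. 0 \<le> a \<and> a < 4 * int s \<longrightarrow> M3 a = M a"
                using M3(2) M2(2) M1(2) by auto
              show "t4 \<le> t + 30 + (if u \<in> S then 50 * N else 0)"
                using t1 t2 t3 t4 time True by simp
            qed (use R1 R2 R3 scan in auto)
          qed (use prems u R1 R2 M1 M2 z_bounds N' inner i in \<open>auto simp: z_def\<close>)
          show "wp traverse \<Phi> R2 M2 t2"
            unfolding traverse_def
            apply (rule wp_While)
             apply (fold traverse_def)
             apply (simp only: visit_def)
             apply (rule wp_Cond)
            using R1 R2 u prems apply simp_all
            apply (rule ret)
            apply simp
            done
        qed (use R1 t1 u prems inner N' Q_pos in auto)
        show ?thesis
          unfolding traverse_def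
          apply -
          apply (rule wp_While)
           apply (fold traverse_def)
           apply (simp only: visit_def block.simps)
           apply (rule wp_intros)+
           apply (use prems i u size_le_B Q_le_B in \<open>simp_all add: u_eq\<close>)
          apply (rule wp_intros)+
            apply (use prems i u size_le_B Q_le_B mark in \<open>simp_all add: u_eq\<close>)
          apply (rule wp_intros)+
            apply (use inner prems i u size_le_B Q_le_B in \<open>simp_all add: u_eq\<close>)
          apply (simp only: call_def block.simps)
          apply (rule wp_intros)+
            apply (rule descend)
          apply (use N' inner prems i u size_le_B Q_le_B int_child_budget[of u N] in \<open>simp_all add: u_eq N'_def\<close>)
          done
      qed
    qed
  qed
qed

end

section \<open>Choice of the precision\<close>

context machine begin

lemma wp_choose_precision:
  assumes "256 * real (length L) < \<epsilon> * 2 ^ \<tau>" "\<And>j. j < \<tau> \<Longrightarrow> \<not> 256 * real (length L) < \<epsilon> * 2 ^ j"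
    and "2 ^ \<tau> \<le> B" "k \<le> \<tau>" "R 2 = 2 ^ k" "R 1 = - int k"
    and "\<And>R' t'. R' 2 = 2 ^ \<tau> \<Longrightarrow> R' 1 = - int \<tau> \<Longrightarrow> (\<forall>r>2. R' r = R r) \<Longrightarrow>
      t' \<le> t + 6 * (\<tau> - k) + 1 \<Longrightarrow> \<Phi> R' M t'"
  shows "wp choose_precision \<Phi> R M t"
  using assms(4-7)
proof (induction "\<tau> - k" arbitrary: k R t)
  case 0
  then have "k = \<tau>" by simp
  then show ?case unfolding choose_precision_def
    by (intro wp_While) (use 0 assms(1) in auto)
next
  case (Suc j)
  note prems = Suc.prems(1-3)
  have k: "k < \<tau>" using Suc.hyps by simp
  have "(2 :: int) ^ Suc k \<le> 2 ^ \<tau>" using k by (intro power_increasing) auto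
  then have k_le: "2 * 2 ^ k \<le> B" using assms(3) by simp
  have "int k < 2 ^ k" by (rule of_nat_less_two_power)
  moreover have "(1 :: int) \<le> 2 ^ k" by simp
  ultimately have k_le': "int k + 1 \<le> B" using k_le by linarith
  have IH: "wp choose_precision \<Phi> R' M t'"
    if "R' 2 = 2 * 2 ^ k" "R' 1 = - int k - 1" "\<forall>r>2. R' r = R r" "t' \<le> t + 6" for R' t'
  proof (rule Suc.hyps(1))
    fix R2 :: "nat \<Rightarrow> int" and t2
    assume "R2 2 = 2 ^ \<tau>" "R2 1 = - int \<tau>" "\<forall>r>2. R2 r = R' r" "t2 \<le> t' + 6 * (\<tau> - Suc k) + 1"
    then show "\<Phi> R2 M t2" using that k by (intro Suc.prems(4)) auto
  qed (use that Suc.hyps(2) k in auto)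
  show ?case
    unfolding choose_precision_def
    apply (rule wp_While)
     apply (fold choose_precision_def)
     apply (simp only: block.simps)
     apply (rule wp_intros)+
       apply (rule IH)
          apply (use prems k_le k_le' assms(2)[OF k] in simp_all)
    done
qed

end

section \<open>The floating-point product of the ratios\<close>

context neighbour_lists begin

text \<open>A root has no parent, so all \<open>d\<close> neighbours may lie in \<open>S\<close>;
  the sink term is then bounded by \<open>(5 / 8) ^ 3 \<le> 1 / 4\<close> rather than by
  \<open>1 / 5\<close>.\<close>

lemma root_estimate_bounds:
  assumes "v < length L" "v \<notin> S"
  shows "3 * Q \<le> 4 * ratio_estimate N S v" "ratio_estimate N S v \<le> Q"
proof -
  define z where "z = scan (child_budget N v) S (L ! v) Q"
  define d where "d = length (L ! v)"
  have scan: "0 \<le> z \<and> z \<le> Q * (1 / 2) ^ length (L ! v) * (5 / 4) ^ card (S \<inter> set (L ! v))"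
    unfolding z_def by (rule scan_bounds[of v]) (use assms Q_pos in auto)
  have card: "card (S \<inter> set (L ! v)) \<le> d"
    unfolding d_def using card_mono[of "set (L ! v)" "S \<inter> set (L ! v)"] card_length[of "L ! v"] by simp
  have "Q * ((1 / 2) ^ length (L ! v) * (5 / 4) ^ card (S \<inter> set (L ! v))) \<le> Q * (1 / 4 :: real)"
  proof (intro mult_left_mono)
    have "(1 / 2) ^ length (L ! v) * (5 / 4) ^ card (S \<inter> set (L ! v)) \<le> (1 / 2) ^ d * (5 / 4 :: real) ^ d"
      unfolding d_def[symmetric] using card by (intro mult_left_mono power_increasing) auto
    also have "\<dots> = (5 / 8) ^ d" by (simp add: power_mult_distrib[symmetric])
    also have "\<dots> \<le> (5 / 8) ^ 3"
      using degree_ge_3[OF assms(1)] by (intro power_decreasing) (auto simp: d_def)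
    also have "\<dots> \<le> 1 / 4" by (simp add: power3_eq_cube)
    finally show "(1 / 2) ^ length (L ! v) * (5 / 4) ^ card (S \<inter> set (L ! v)) \<le> (1 / 4 :: real)" .
  qed (use Q_pos in auto)
  then have "real_of_int (4 * z) \<le> Q" using scan by (simp add: mult.assoc)
  then have "4 * z \<le> Q" by linarith
  then show "3 * Q \<le> 4 * ratio_estimate N S v" "ratio_estimate N S v \<le> Q"
    using scan Q_pos by (auto simp: ratio_estimate_def z_def)
qed

text \<open>Mantissa and exponent after the roots below \<open>v\<close>. With
  \<open>Q = 2 ^ \<tau>\<close> and \<open>e = - \<tau>\<close> the initial pair denotes 1.\<close>

primrec product :: "int \<Rightarrow> nat \<Rightarrow> int \<times> int" where
  "product e 0 = (Q, e)"
| "product e (Suc v) =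
     (let a = fst (product e v) * ratio_estimate (nat Q) {..<v} v div Q
      in if a < Q then (2 * a, snd (product e v) - 1) else (a, snd (product e v)))"

lemma product_bounds:
  assumes "even Q" "v \<le> length L"
  shows "Q \<le> fst (product e v)" "fst (product e v) < 2 * Q" "snd (product e v) \<le> e" "e - int v \<le> snd (product e v)"
proof -
  have "Q \<le> fst (product e v) \<and> fst (product e v) < 2 * Q \<and> snd (product e v) \<le> e \<and> e - int v \<le> snd (product e v)"
    using assms(2)
  proof (induction v)
    case 0
    then show ?case using Q_pos by simp
  next
    case (Suc v)
    define a where "a = fst (product e v)"
    define r where "r = ratio_estimate (nat Q) {..<v} v"
    have r: "3 * Q \<le> 4 * r" "r \<le> Q" using root_estimate_bounds[of v "{..<v}"] Suc.prems by (auto simp: r_def)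
    \<comment> \<open>As \<open>Q / 2\<close> is an integer, the lower bound \<open>Q / 2\<close>
      passes through the floor of the division.\<close>
    obtain h where h: "Q = 2 * h" using assms(1) by blast
    have a: "Q \<le> a" "a < 2 * Q" using Suc by (auto simp: a_def)
    have "Q * h \<le> a * r" using r a Q_pos h by (intro mult_mono) auto
    then have "Q * h div Q \<le> a * r div Q" using Q_pos by (intro zdiv_mono1) auto
    then have "Q \<le> 2 * (a * r div Q)" using Q_pos h by simp
    moreover have "a * r div Q \<le> a * Q div Q" using r a Q_pos by (intro zdiv_mono1 mult_left_mono) auto
    ultimately show ?case using a Suc Q_pos by (auto simp: Let_def a_def r_def)
  qed
  then show "Q \<le> fst (product e v)" "fst (product e v) < 2 * Q" "snd (product e v) \<le> e" "e - int v \<le> snd (product e v)"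
    by auto
qed

end

section \<open>The program at the roots and as a whole\<close>

context traversal begin

text \<open>At depth 0 no value of a parent is divided by the ratio, so \<open>x \<le> Q\<close>
  suffices, and the loop flag is cleared instead of a frame being restored.\<close>

lemma wp_return_root:
  assumes "R 4 = int u" "u < length L" "R 5 = int (length (L ! u))" "int (length (L ! u)) \<le> Q"
    and "R 2 = Q" "R 8 = 0" "R 6 = x" "0 \<le> x" "x \<le> Q"
    and "\<And>R' M' t'. R' 10 = Q - x \<Longrightarrow> R' 12 = 0 \<Longrightarrow> (\<forall>r. r < 4 \<or> r = 11 \<longrightarrow> R' r = R r) \<Longrightarrow>
      (\<forall>w<length L. M' (- 1 - int w) =
         (if w \<in> set (L ! u) \<and> M (- 1 - int w) < 0 then 1 else M (- 1 - int w))) \<Longrightarrow>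
      t' \<le> t + 8 * length (L ! u) + 20 \<Longrightarrow> \<Phi> R' M' t'"
  shows "wp return \<Phi> R M t"
  unfolding return_def block.simps
proof (rule wp_Seq, rule wp_unmark[where s=0])
  fix R' M' t'
  assume R': "\<forall>r. r \<noteq> 5 \<and> r \<noteq> 9 \<longrightarrow> R' r = R r"
    and M': "\<forall>w<length L. M' (- 1 - int w) = (if w \<in> set (take (length (L ! u)) (L ! u)) \<and>
      M (- 1 - int w) < - int 0 then 1 else M (- 1 - int w))" "\<forall>a\<ge>0. M' a = M a"
    and t': "t' \<le> Suc t + 8 * length (L ! u) + 1"
  show "wp (Seq (Assign 10 (Minus (Reg 2) (Reg 6))) (Cond (Less (Num 0) (Reg 8))
      (Seq (Assign 8 (Minus (Reg 8) (Num 1)))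
        (Seq (Assign 4 (Load (frame_addr 0)))
          (Seq (Assign 5 (Plus (Load (frame_addr 1)) (Num 1)))
            (Seq (Assign 6 (Divide (Times (Load (frame_addr 2)) (Reg 2)) (Times (Num 2) (Reg 10))))
              (Assign 7 (Load (frame_addr 3)))))))
      (Assign 12 (Num 0)))) \<Phi> R' M' t'"
    apply (rule wp_intros)+
     apply (use assms(1-9) R' M' size_le_B Q_le_B in simp_all)
    apply (rule wp_intros)+
     apply (rule assms(10))
    apply (use assms(1-9) R' M' t' size_le_B Q_le_B in simp_all)
    done
qed (use assms in auto)

lemma wp_estimate_ratio:
  assumes "R 2 = Q" "R 3 = int v" "v < length L"
    and marks: "\<forall>w<length L. M (- 1 - int w) = of_bool (w < v)"
    and cont: "\<And>R' M' t'. R' 10 = ratio_estimate (nat Q) {..<v} v \<Longrightarrow>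
      (\<forall>r. r < 4 \<or> r = 11 \<longrightarrow> R' r = R r) \<Longrightarrow>
      (\<forall>w<length L. M' (- 1 - int w) = of_bool (w < v)) \<Longrightarrow>
      t' \<le> t + 140 * nat Q + 60 \<Longrightarrow> \<Phi> R' M' t'"
  shows "wp estimate_ratio \<Phi> R M t"
proof (cases "Q < int (length (L ! v))")
  case True
  then have "nat Q < length (L ! v)" using Q_pos by (simp add: nat_less_iff)
  then have "ratio_estimate (nat Q) {..<v} v = Q" by (simp add: ratio_estimate_def)
  then show ?thesis
    unfolding estimate_ratio_def
    apply -
    apply (rule wp_intros)
    apply (use True assms(1-3) in simp_all)
    apply (rule wp_intros)+
     apply (rule cont)
    using assms(1-3) marks Q_le_B Q_pos apply simp_all
    done
next
  case False
  define d where "d = length (L ! v)"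
  define N where "N = child_budget (nat Q) v"
  define z where "z = scan N {..<v} (L ! v) Q"
  have d: "3 \<le> d" "d \<le> nat Q" using False degree_ge_3[of v] assms by (auto simp: d_def)
  have z: "ratio_estimate (nat Q) {..<v} v = Q - z"
    using d by (simp add: ratio_estimate_def z_def N_def d_def)
  have N: "N < nat Q" unfolding N_def by (rule child_budget_less) (use assms d in \<open>auto simp: d_def\<close>)
  have scan: "0 \<le> z \<and> z \<le> Q * (1 / 2) ^ length (L ! v) * (5 / 4) ^ card ({..<v} \<inter> set (L ! v))"
    unfolding z_def by (rule scan_bounds[of v]) (use assms Q_pos in auto)
  have card: "card ({..<v} \<inter> set (L ! v)) \<le> d"
    unfolding d_def using card_mono[of "set (L ! v)" "{..<v} \<inter> set (L ! v)"] card_length[of "L ! v"] by simp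
  have "Q * ((1 / 2) ^ length (L ! v) * (5 / 4) ^ card ({..<v} \<inter> set (L ! v))) \<le> Q * (1 :: real)"
  proof (intro mult_left_mono)
    have "(1 / 2) ^ length (L ! v) * (5 / 4) ^ card ({..<v} \<inter> set (L ! v)) \<le> (1 / 2) ^ d * (5 / 4 :: real) ^ d"
      unfolding d_def[symmetric] using card by (intro mult_left_mono power_increasing) auto
    also have "\<dots> \<le> 1" by (simp add: power_mult_distrib[symmetric] power_le_one)
    finally show "(1 / 2) ^ length (L ! v) * (5 / 4) ^ card ({..<v} \<inter> set (L ! v)) \<le> (1 :: real)" .
  qed (use Q_pos in auto)
  then have z_bounds: "0 \<le> z" "z \<le> Q" using scan by (auto simp: mult.assoc)
  have "N * card ({..<v} \<inter> set (L ! v)) \<le> N * d" using card by simp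
  \<comment> \<open>The budget of the root is divided by \<open>d - 1\<close> although it may have
    \<open>d\<close> children; this costs at most a factor 2.\<close>
  also have "\<dots> \<le> 2 * (N * (d - 1))" using d by (cases d) auto
  also have "N * (d - 1) \<le> nat Q - d" using child_budget_mult[of "nat Q" v] by (simp add: N_def d_def)
  finally have time: "30 * d + 50 * (N * card ({..<v} \<inter> set (L ! v))) + 8 * d \<le> 138 * nat Q"
    using d by simp
  have finish: "wp traverse \<Phi> R' M' t'"
    if R': "R' 4 = int v" "R' 5 = int (length (L ! v))" "R' 6 = scan N {..<v} (L ! v) Q" "R' 8 = int 0"
      "R' 2 = Q" "R' 12 = 1" "\<forall>r. r < 4 \<or> r = 11 \<longrightarrow> R' r = R r"
      and M': "\<forall>w<length L. M' (- 1 - int w) =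
        (if w \<in> {..<v} \<inter> set (L ! v) then - 1 - int 0 else M (- 1 - int w))"
      and t': "t' \<le> t + 14 + 30 * length (L ! v) + 50 * N * card ({..<v} \<inter> set (L ! v))"
    for R' M' t'
  proof -
    have ret: "wp return (wp traverse \<Phi>) R' M' t1" if t1: "t1 \<le> t' + 2" for t1
    proof (rule wp_return_root)
      fix R2 M2 t2
      assume R2: "R2 10 = Q - z" "R2 12 = 0" "\<forall>r. r < 4 \<or> r = 11 \<longrightarrow> R2 r = R' r"
        and M2: "\<forall>w<length L. M2 (- 1 - int w) =
           (if w \<in> set (L ! v) \<and> M' (- 1 - int w) < 0 then 1 else M' (- 1 - int w))"
        and t2: "t2 \<le> t1 + 8 * length (L ! v) + 20"
      show "wp traverse \<Phi> R2 M2 t2" unfolding traverse_def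
      proof (rule wp_While)
        show "\<Phi> R2 M2 (Suc t2)"
        proof (rule cont)
          show "\<forall>w<length L. M2 (- 1 - int w) = of_bool (w < v)" using M2 M' marks by auto
          show "Suc t2 \<le> t + 140 * nat Q + 60"
            using t2 t1 t' time d by (simp add: d_def mult.assoc)
        qed (use R2 R' z in auto)
      qed (use R2 in auto)
    qed (use R' assms z_bounds d in \<open>auto simp: z_def d_def\<close>)
    show ?thesis
      unfolding traverse_def
      apply (rule wp_While)
       apply (fold traverse_def)
       apply (simp only: visit_def)
       apply (rule wp_Cond)
      using R' assms apply simp_all
      apply (rule ret)
      apply simp
      done
  qed
  show ?thesis
    unfolding estimate_ratio_def
    apply (rule wp_intros)
    apply (use False assms(1-3) in \<open>simp_all\<close>)
    apply (rule wp_intros)+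
          apply (rule wp_traverse[where i=0 and v=v and us="L ! v" and S="{..<v}" and s=0 and N=N and x=Q])
                         apply (use False assms(1-3) marks N int_child_budget[of v "nat Q"] Q_pos size_le_B Q_le_B in
                           \<open>simp_all add: marked_def N_def\<close>)
    apply (rule finish)
    apply (simp_all add: N_def)
    done
qed


lemma wp_multiply_ratios:
  assumes "even Q" "\<bar>e\<bar> \<le> Q" "Q + int (length L) + int (\<Sum>w<length L. length (L ! w)) \<le> B"
    and "v \<le> length L" "R 0 = fst (product e v)" "R 1 = snd (product e v)" "R 2 = Q" "R 3 = int v"
    and "R 11 = int (\<Sum>w<v. length (L ! w))"
    and "\<forall>w<length L. M (- 1 - int w) = of_bool (w < v)"
    and "\<And>R' M' t'. R' 0 = fst (product e (length L)) \<Longrightarrow> R' 1 = snd (product e (length L)) \<Longrightarrow>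
      R' 11 = int (\<Sum>w<length L. length (L ! w)) \<Longrightarrow>
      t' \<le> t + (length L - v) * (140 * nat Q + 90) + 1 \<Longrightarrow> \<Phi> R' M' t'"
  shows "wp multiply_ratios \<Phi> R M t"
  using assms(4-11)
proof (induction "length L - v" arbitrary: v R M t)
  case 0
  show ?case unfolding multiply_ratios_def
    by (rule wp_While) (use 0 in auto)
next
  case (Suc k)
  note prems = Suc.prems(1-7)
  have v: "v < length L" using Suc.hyps by simp
  define a where "a = fst (product e v) * ratio_estimate (nat Q) {..<v} v div Q"
  define s where "s = int (\<Sum>w<Suc v. length (L ! w))"
  have s: "s = int (\<Sum>w<v. length (L ! w)) + int (length (L ! v))" by (simp add: s_def)
  have s_le: "s \<le> B"
  proof -
    have "(\<Sum>w<Suc v. length (L ! w)) \<le> (\<Sum>w<length L. length (L ! w))"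
      using v by (intro sum_mono2) auto
    then show ?thesis using assms(3) Q_pos unfolding s_def by linarith
  qed
  have s_ge: "0 \<le> s" unfolding s_def by (rule of_nat_0_le_iff)
  have a: "0 \<le> a" "a < 2 * Q"
  proof -
    have r: "3 * Q \<le> 4 * ratio_estimate (nat Q) {..<v} v" "ratio_estimate (nat Q) {..<v} v \<le> Q"
      using root_estimate_bounds[of v "{..<v}"] v by auto
    have *: "Q \<le> fst (product e v)" "fst (product e v) < 2 * Q" using product_bounds[OF assms(1)] v by auto
    have "a \<le> fst (product e v) * Q div Q"
      unfolding a_def using r * Q_pos by (intro zdiv_mono1 mult_left_mono) auto
    then show "a < 2 * Q" using * Q_pos by simp
    show "0 \<le> a" unfolding a_def using r * Q_pos by (simp add: pos_imp_zdiv_nonneg_iff)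
  qed
  have "Q + int (length L) \<le> B"
    using assms(3) of_nat_0_le_iff[of "\<Sum>w<length L. length (L ! w)", where 'a = int] by linarith
  then have bounds: "\<bar>snd (product e v)\<bar> \<le> B" "\<bar>snd (product e v) - 1\<bar> \<le> B" "int v + 1 \<le> B"
    using product_bounds(3,4)[OF assms(1), of v e] v assms(2) Q_pos by auto
  have IH: "wp multiply_ratios \<Phi> R' M' t'"
    if "R' 0 = (if a < Q then 2 * a else a)" "R' 1 = (if a < Q then snd (product e v) - 1 else snd (product e v))"
      "R' 2 = Q" "R' 3 = int v + 1" "R' 11 = s"
      "\<forall>w<length L. M' (- 1 - int w) = of_bool (w < Suc v)" "t' \<le> t + 140 * nat Q + 90" for R' M' t'
  proof (rule Suc.hyps(1))
    fix R2 :: "nat \<Rightarrow> int" and M2 :: "int \<Rightarrow> int" and t2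
    assume *: "R2 0 = fst (product e (length L))" "R2 1 = snd (product e (length L))"
      "R2 11 = int (\<Sum>w<length L. length (L ! w))"
      "t2 \<le> t' + (length L - Suc v) * (140 * nat Q + 90) + 1"
    have "length L - v = Suc (length L - Suc v)" using v by simp
    then have "t2 \<le> t + (length L - v) * (140 * nat Q + 90) + 1" using *(4) that(7) by simp
    then show "\<Phi> R2 M2 t2" using * Suc.prems(8) by blast
  qed (use that Suc.hyps(2) v in \<open>auto simp: s_def a_def\<close>)
  show ?case
    unfolding multiply_ratios_def
    apply (rule wp_While)
     apply (fold multiply_ratios_def)
     apply (simp only: block.simps)
     apply (rule wp_Seq)
     apply (rule wp_estimate_ratio[where v=v])
         apply (use v prems in simp_all)[4]
     apply (rule wp_intros)+
        apply (use v prems bounds Q_le_B Q_pos a s s_le s_ge in \<open>simp_all add: a_def[symmetric]\<close>)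
    apply (intro conjI impI)
    subgoal
      apply (rule wp_intros)+
          apply (rule IH)
                apply (use v prems bounds Q_le_B Q_pos a s s_le s_ge in \<open>simp_all add: a_def[symmetric]\<close>)
      done
    subgoal
      apply (rule wp_intros)+
        apply (rule IH)
              apply (use v prems bounds Q_le_B Q_pos a s s_le s_ge in \<open>simp_all add: a_def[symmetric]\<close>)
      done
    done
qed

lemma wp_count_program:
  assumes "256 * real (length L) < \<epsilon> * 2 ^ \<tau>" "\<And>j. j < \<tau> \<Longrightarrow> \<not> 256 * real (length L) < \<epsilon> * 2 ^ j"
    and Q: "Q = 2 ^ \<tau>" "0 < \<tau>"
    and B: "2 * Q + int (length L) + 2 * int (\<Sum>w<length L. length (L ! w)) \<le> B"
  shows "wp count_program (\<lambda>R M t. R 0 = fst (product (- int \<tau>) (length L)) \<and>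
    R 1 = snd (product (- int \<tau>) (length L)) + int ((\<Sum>w<length L. length (L ! w)) div 2) \<and>
    t \<le> 6 * \<tau> + length L * (140 * nat Q + 90) + 12) (\<lambda>_. 0) (\<lambda>_. 0) 0"
proof -
  define s where "s = (\<Sum>w<length L. length (L ! w))"
  define e where "e = snd (product (- int \<tau>) (length L))"
  have Q_even: "even Q" using Q by simp
  have \<tau>: "int \<tau> \<le> Q" using of_nat_less_two_power[of \<tau>, where 'a = int] Q by simp
  have e: "\<bar>e\<bar> \<le> Q + int (length L)"
    using product_bounds(3,4)[OF Q_even, of "length L" "- int \<tau>"] \<tau> by (auto simp: e_def)
  have final: "\<bar>e + int (s div 2)\<bar> \<le> B"
  proof -
    have "int (s div 2) \<le> int s" "0 \<le> int (s div 2)" by auto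
    then show ?thesis using e B Q_pos by (simp only: s_def[symmetric])
  qed
  have "wp multiply_ratios (wp (Assign 1 (Plus (Reg 1) (Divide (Reg 11) (Num 2)))) (\<lambda>R M t.
      R 0 = fst (product (- int \<tau>) (length L)) \<and> R 1 = e + int (s div 2) \<and>
      t \<le> 6 * \<tau> + length L * (140 * nat Q + 90) + 12)) R (\<lambda>_. 0) t"
    if "R 0 = Q" "R 1 = - int \<tau>" "R 2 = Q" "R 3 = 0" "R 11 = 0" "t \<le> 6 * \<tau> + 10" for R t
  proof (rule wp_multiply_ratios[OF Q_even])
    show "\<bar>- int \<tau>\<bar> \<le> Q" using \<tau> by simp
    show "Q + int (length L) + int (\<Sum>w<length L. length (L ! w)) \<le> B" using B Q_pos by linarith
    fix R' :: "nat \<Rightarrow> int" and M' :: "int \<Rightarrow> int" and t'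
    assume "R' 0 = fst (product (- int \<tau>) (length L))" "R' 1 = snd (product (- int \<tau>) (length L))"
      "R' 11 = int (\<Sum>w<length L. length (L ! w))" "t' \<le> t + (length L - 0) * (140 * nat Q + 90) + 1"
    then show "wp (Assign 1 (Plus (Reg 1) (Divide (Reg 11) (Num 2)))) (\<lambda>R M t.
      R 0 = fst (product (- int \<tau>) (length L)) \<and> R 1 = e + int (s div 2) \<and>
      t \<le> 6 * \<tau> + length L * (140 * nat Q + 90) + 12) R' M' t'"
      apply (fold s_def e_def)
      apply (rule wp_Assign)
      using final that(6) apply (simp_all add: zdiv_int)
      done
  qed (use that in auto)
  note ratios = this
  have \<tau>_le: "2 ^ \<tau> \<le> B" using Q(1) Q_pos Q_le_B by linarith
  show ?thesis
    unfolding count_program_def block.simps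
    apply (fold s_def e_def)
    apply (rule wp_Seq, rule wp_Assign, rule wp_Seq)
     apply (rule wp_choose_precision[where k=0 and \<tau>=\<tau>])
           apply (use assms(1,2) \<tau>_le in simp_all)[6]
    subgoal
      apply (rule wp_Seq, rule wp_Assign, rule wp_Seq, rule ratios)
      using Q(1) Q_pos Q_le_B \<tau>_le apply simp_all
      done
    using Q_pos Q_le_B apply simp
    done
qed

end

section \<open>From preconditions to runs\<close>

context machine begin

text \<open>A halted configuration is a fixed point of \<open>step\<close>, which extends the word
  bound from the times up to \<open>t\<close> to all times.\<close>

lemma run_wp:
  assumes "wp P \<Phi> (\<lambda>_. 0) (\<lambda>_. 0) 0" "0 \<le> B"
  obtains R M t where "run P L \<epsilon> t = return_pmf ([], R, M)" "\<Phi> R M t" "uses_words_below P L \<epsilon> (real_of_int B)"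
proof -
  have "words_le (\<lambda>_. 0) (\<lambda>_. 0)" using assms(2) by (simp add: words_le_def)
  then obtain t R M where p: "\<And>cs. path t (P # cs, \<lambda>_. 0, \<lambda>_. 0) (cs, R, M)" and \<Phi>: "\<Phi> R M t"
    using assms(1) by (auto simp: wp_def)
  have run: "run P L \<epsilon> t = return_pmf ([], R, M)" using p[of "[]"] by (simp add: run_def path_def)
  have idle: "steps L \<epsilon> j ([], R, M) = return_pmf ([], R, M)" for j
    by (induction j) (simp_all add: bind_return_pmf)
  have words: "words_le R' M'" if "(cs, R', M') \<in> set_pmf (run P L \<epsilon> j)" for j cs R' M'
  proof (cases "j \<le> t")
    case True
    then show ?thesis using p[of "[]"] that unfolding path_def run_def by fast
  next
    case False
    then have "run P L \<epsilon> j = return_pmf ([], R, M)"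
      using steps_add[of t "j - t" "([P], \<lambda>_. 0, \<lambda>_. 0)"] run by (simp add: run_def bind_return_pmf idle)
    then show ?thesis using that path_words(2)[OF p] by simp
  qed
  have "uses_words_below P L \<epsilon> (real_of_int B)"
    using words by (fastforce simp: uses_words_below_def words_le_def simp flip: of_int_abs)
  then show thesis using run \<Phi> that by blast
qed

end

section \<open>Contraction of the ratio recursion\<close>

text \<open>For a vertex of degree \<open>D + 1\<close>, the first bound gives the contraction, the
  second the error of a leaf, the third the error of a root.\<close>

lemma five_eighths_power_bounds:
  assumes "2 \<le> D"
  shows "(5 / 8 :: real) ^ D * (real D ^ 2 + 6) \<le> 4"
    and "(5 / 8 :: real) ^ D * (real D + 4) \<le> 8 / 3"
    and "(5 / 8 :: real) ^ D * (real D * (real D + 1)) \<le> 16 / 5"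
proof -
  show "(5 / 8 :: real) ^ D * (real D ^ 2 + 6) \<le> 4" using assms
  proof (induction D rule: dec_induct)
    case (step D)
    \<comment> \<open>The square completes \<open>3 * D ^ 2 - 10 * D + 13\<close>, eight times the
      difference of the two sides of the next inequality.\<close>
    have "0 \<le> 3 * (real D - 5 / 3) ^ 2 + 14 / 3" by simp
    then have "5 / 8 * (real (Suc D) ^ 2 + 6) \<le> real D ^ 2 + 6"
      by (simp add: power2_eq_square algebra_simps)
    then have "(5 / 8) ^ D * (5 / 8 * (real (Suc D) ^ 2 + 6)) \<le> (5 / 8) ^ D * (real D ^ 2 + 6)"
      by (intro mult_left_mono) auto
    also have "\<dots> \<le> 4" by (rule step.IH)
    finally show ?case by (simp only: power_Suc mult_ac)
  qed (simp add: power2_eq_square)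
  show "(5 / 8 :: real) ^ D * (real D + 4) \<le> 8 / 3" using assms
  proof (induction D rule: dec_induct)
    case (step D)
    have "(5 / 8) ^ D * (5 / 8 * (real (Suc D) + 4)) \<le> (5 / 8) ^ D * (real D + 4)"
      by (intro mult_left_mono) auto
    also have "\<dots> \<le> 8 / 3" by (rule step.IH)
    finally show ?case by (simp only: power_Suc mult_ac)
  qed (simp add: power2_eq_square)
  \<comment> \<open>The third expression still grows up to \<open>D = 4\<close>, so its induction
    starts only there.\<close>
  consider "D = 2" | "D = 3" | "4 \<le> D" using assms by linarith
  then show "(5 / 8 :: real) ^ D * (real D * (real D + 1)) \<le> 16 / 5"
  proof cases
    case 3
    then show ?thesis
    proof (induction D rule: dec_induct)
      case (step D)
      have "5 / 8 * (real (Suc D) * (real (Suc D) + 1)) = 5 / 8 * (real D + 2) * (real D + 1)"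
        by (simp add: algebra_simps)
      also have "\<dots> \<le> real D * (real D + 1)" using step.hyps by (intro mult_right_mono) auto
      finally have "(5 / 8) ^ D * (5 / 8 * (real (Suc D) * (real (Suc D) + 1)))
          \<le> (5 / 8) ^ D * (real D * (real D + 1))"
        by (intro mult_left_mono) auto
      also have "\<dots> \<le> 16 / 5" by (rule step.IH)
      finally show ?case by (simp only: power_Suc mult_ac)
    qed (simp add: eval_nat_numeral)
  qed (simp_all add: eval_nat_numeral)
qed

text \<open>The left-hand side increases in every \<open>y j\<close>, so the worst case is \<open>y j = 5 / 4\<close> throughout.\<close>

lemma prod_times_sum_le:
  fixes y :: "'i \<Rightarrow> real" and \<tau> :: real
  assumes "finite J" "\<And>j. j \<in> J \<Longrightarrow> 0 < y j \<and> y j \<le> 5 / 4" "0 \<le> D" "0 \<le> D * (real (card J) - 5) / 6 + \<tau>"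
  shows "prod y J * (D * (\<Sum>j\<in>J. 1 - 2 / 3 * y j) + \<tau>) \<le> (5 / 4) ^ card J * (D * card J / 6 + \<tau>)"
  using assms
proof (induction J arbitrary: \<tau> rule: finite_induct)
  case (insert i J)
  define \<Sigma> where "\<Sigma> = (\<Sum>j\<in>J. 1 - 2 / 3 * y j)"
  have i: "0 < y i" "y i \<le> 5 / 4" using insert.prems by auto
  have "(\<Sum>j\<in>J. 1 / 6 :: real) \<le> \<Sigma>"
    unfolding \<Sigma>_def using insert.prems by (intro sum_mono) fastforce
  then have \<Sigma>: "real (card J) / 6 \<le> \<Sigma>" by simp
  have "0 \<le> D * (real (card J) - 4) / 6 + \<tau>" using insert by simp
  also have "\<dots> = D * (real (card J) / 6 - 2 / 3) + \<tau>" by (simp add: field_simps)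
  also have "\<dots> \<le> D * (\<Sigma> + (1 - 2 / 3 * (5 / 4 + y i))) + \<tau>"
  proof (intro add_right_mono mult_left_mono)
    show "real (card J) / 6 - 2 / 3 \<le> \<Sigma> + (1 - 2 / 3 * (5 / 4 + y i))" using \<Sigma> i by argo
  qed (rule insert.prems)
  \<comment> \<open>This is the increase of the quadratic
    \<open>y * (D * (1 - 2 / 3 * y + \<Sigma>) + \<tau>)\<close> from \<open>y i\<close> to
    \<open>5 / 4\<close>. The hypothesis with \<open>card J - 5\<close> is the value of the second
    factor when every \<open>y j\<close> is \<open>5 / 4\<close>.\<close>
  finally have "0 \<le> (5 / 4 - y i) * (D * (\<Sigma> + (1 - 2 / 3 * (5 / 4 + y i))) + \<tau>)"
    using i by (intro mult_nonneg_nonneg) auto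
  also have "\<dots> = 5 / 4 * (D * \<Sigma> + (\<tau> + D / 6)) - y i * (D * (1 - 2 / 3 * y i + \<Sigma>) + \<tau>)"
    by algebra
  finally have *: "y i * (D * (1 - 2 / 3 * y i + \<Sigma>) + \<tau>) \<le> 5 / 4 * (D * \<Sigma> + (\<tau> + D / 6))"
    by linarith
  have "prod y (insert i J) * (D * (\<Sum>j\<in>insert i J. 1 - 2 / 3 * y j) + \<tau>)
      = prod y J * (y i * (D * (1 - 2 / 3 * y i + \<Sigma>) + \<tau>))"
    using insert by (simp add: \<Sigma>_def)
  also have "\<dots> \<le> prod y J * (5 / 4 * (D * \<Sigma> + (\<tau> + D / 6)))"
    using insert.prems by (intro mult_left_mono * prod_nonneg) (auto simp: less_imp_le)
  also have "\<dots> = 5 / 4 * (prod y J * (D * \<Sigma> + (\<tau> + D / 6)))" by simp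
  also have "\<dots> \<le> 5 / 4 * ((5 / 4) ^ card J * (D * card J / 6 + (\<tau> + D / 6)))"
    unfolding \<Sigma>_def using insert.prems insert.hyps
    by (intro mult_left_mono insert.IH) (auto simp: algebra_simps add_divide_distrib diff_divide_distrib)
  finally show ?case using insert.hyps by (simp add: algebra_simps add_divide_distrib)
qed auto

text \<open>The argument \<open>z j\<close> stands for \<open>r\<^sub>j - 2 / 3\<close>.\<close>

definition sink_weight :: "nat \<Rightarrow> 'i set \<Rightarrow> ('i \<Rightarrow> real) \<Rightarrow> real" where
  "sink_weight d J z = (1 / 2) ^ d * (\<Prod>j\<in>J. 1 / (z j + 2 / 3))"

lemma sink_weight_nonneg: "\<forall>j\<in>J. 2 / 15 \<le> z j \<Longrightarrow> 0 \<le> sink_weight d J z"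
  unfolding sink_weight_def by (intro mult_nonneg_nonneg prod_nonneg) fastforce+

lemma sink_weight_le:
  assumes "\<forall>j\<in>J. 2 / 15 \<le> z j" "card J \<le> m"
  shows "sink_weight d J z \<le> (1 / 2) ^ d * (5 / 4) ^ m"
proof -
  have "(\<Prod>j\<in>J. 1 / (z j + 2 / 3)) \<le> (\<Prod>j\<in>J. 5 / 4)"
    using assms by (intro prod_mono) (fastforce simp: field_simps)
  also have "\<dots> = (5 / 4) ^ card J" by simp
  also have "\<dots> \<le> (5 / 4) ^ m" using assms by (intro power_increasing) auto
  finally show ?thesis unfolding sink_weight_def by (intro mult_left_mono) auto
qed

lemma sink_weight_antimono:
  assumes "\<forall>j\<in>J. 0 \<le> z j \<and> z j \<le> w j"
  shows "sink_weight d J w \<le> sink_weight d J z"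
  unfolding sink_weight_def using assms
  by (intro mult_left_mono prod_mono) (fastforce intro!: divide_left_mono mult_pos_pos)+

text \<open>When all \<open>z j\<close> are scaled by \<open>exp s\<close>, the weight falls at the
  rate on the left of the second claim, so this claim bounds the logarithmic derivative of
  \<open>1 / 3 - sink_weight\<close> by \<open>1 / D\<close>. Equivalently, the weight times
  \<open>D * \<Sigma> + 1\<close> is at most \<open>1 / 3\<close>, with \<open>\<Sigma>\<close> the
  sum.\<close>

lemma sink_weight_contracts:
  assumes "finite J" "2 \<le> D" "card J \<le> D" "\<forall>j\<in>J. 2 / 15 \<le> z j"
  shows "2 / 15 \<le> 1 / 3 - sink_weight (Suc D) J z"
    and "sink_weight (Suc D) J z * (\<Sum>j\<in>J. z j / (z j + 2 / 3)) \<le> 1 / D * (1 / 3 - sink_weight (Suc D) J z)"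
proof -
  have "sink_weight (Suc D) J z \<le> (1 / 2) ^ Suc D * (5 / 4) ^ D" using assms by (intro sink_weight_le)
  also have "\<dots> = 1 / 2 * (5 / 8) ^ D" by (simp add: power_mult_distrib[symmetric])
  also have "\<dots> \<le> 1 / 2 * (5 / 8) ^ 2" using assms by (intro mult_left_mono power_decreasing) auto
  also have "\<dots> \<le> 1 / 5" by (simp add: power2_eq_square)
  finally show "2 / 15 \<le> 1 / 3 - sink_weight (Suc D) J z" by simp
  define y where "y j = 1 / (z j + 2 / 3)" for j
  define \<Sigma> where "\<Sigma> = (\<Sum>j\<in>J. 1 - 2 / 3 * y j)"
  have y: "0 < y j \<and> y j \<le> 5 / 4" if "j \<in> J" for j
    using assms(4) that by (fastforce simp: y_def field_simps)
  have \<Sigma>: "(\<Sum>j\<in>J. z j / (z j + 2 / 3)) = \<Sigma>"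
    unfolding \<Sigma>_def using assms(4) by (intro sum.cong refl) (fastforce simp: y_def field_simps)
  \<comment> \<open>Each of the \<open>D - card J\<close> absent children is counted with the
    worst-case summand \<open>1 / 6\<close>. The bracket on the right then no longer depends on
    \<open>card J\<close>, and monotonicity comes down to
    \<open>(D - 2) * (D - 3) \<ge> 0\<close>.\<close>
  define \<tau> where "\<tau> = 1 + real D * (real D - real (card J)) / 6"
  have "0 \<le> (real D - 2) * (real D - 3)"
  proof (cases "D = 2")
    case False
    then have "3 \<le> real D" using assms(2) by simp
    then show ?thesis by simp
  qed simp
  then have "0 \<le> real D * (real (card J) - 5) / 6 + \<tau>"
    by (simp add: \<tau>_def field_simps)
  then have "prod y J * (real D * \<Sigma> + \<tau>) \<le> (5 / 4) ^ card J * (real D * card J / 6 + \<tau>)"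
    unfolding \<Sigma>_def using assms y by (intro prod_times_sum_le) auto
  also have "real D * card J / 6 + \<tau> = (real D ^ 2 + 6) / 6"
    by (simp add: \<tau>_def field_simps power2_eq_square)
  also have "(5 / 4) ^ card J * ((real D ^ 2 + 6) / 6) \<le> (5 / 4) ^ D * ((real D ^ 2 + 6) / 6)"
    using assms by (intro mult_right_mono power_increasing) auto
  finally have "prod y J * (real D * \<Sigma> + \<tau>) \<le> (5 / 4) ^ D * ((real D ^ 2 + 6) / 6)" .
  moreover have "prod y J * (real D * \<Sigma> + 1) \<le> prod y J * (real D * \<Sigma> + \<tau>)"
    using assms y by (intro mult_left_mono prod_nonneg) (auto simp: \<tau>_def less_imp_le)
  ultimately have "(1 / 2) ^ Suc D * (prod y J * (real D * \<Sigma> + 1)) \<le> (1 / 2) ^ Suc D * ((5 / 4) ^ D * ((real D ^ 2 + 6) / 6))"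
    by (intro mult_left_mono) auto
  also have "\<dots> = (5 / 8) ^ D * (real D ^ 2 + 6) / 12"
    by (simp add: power_mult_distrib[symmetric] mult.assoc[symmetric])
  also have "\<dots> \<le> 1 / 3" using five_eighths_power_bounds(1)[OF assms(2)] by (simp add: mult.commute)
  also have "(1 / 2) ^ Suc D * (prod y J * (real D * \<Sigma> + 1)) = sink_weight (Suc D) J z * (real D * \<Sigma> + 1)"
    by (simp add: sink_weight_def y_def)
  finally show "sink_weight (Suc D) J z * (\<Sum>j\<in>J. z j / (z j + 2 / 3)) \<le> 1 / D * (1 / 3 - sink_weight (Suc D) J z)"
    using assms(2) unfolding \<Sigma> by (simp add: field_simps)
qed

text \<open>The root is measured by the plain logarithm, and its constant only has to offset the
  factor \<open>d - 1\<close> by which the budget of the children is smaller; the decay of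
  \<open>(5 / 8) ^ d\<close> does this.\<close>

lemma sink_weight_root:
  assumes "finite J" "3 \<le> d" "card J \<le> d" "\<forall>j\<in>J. 2 / 15 \<le> z j"
  shows "3 / 4 \<le> 1 - sink_weight d J z"
    and "sink_weight d J z * (\<Sum>j\<in>J. z j / (z j + 2 / 3)) \<le> 4 / 3 * d * (5 / 8) ^ d * (1 - sink_weight d J z)"
proof -
  have "sink_weight d J z \<le> (1 / 2) ^ d * (5 / 4) ^ d" using assms by (intro sink_weight_le)
  also have eq: "\<dots> = (5 / 8) ^ d" by (simp add: power_mult_distrib[symmetric])
  finally have le: "sink_weight d J z \<le> (5 / 8) ^ d" .
  also have "(5 / 8 :: real) ^ d \<le> (5 / 8) ^ 3" using assms by (intro power_decreasing) auto
  also have "\<dots> \<le> 1 / 4" by (simp add: power3_eq_cube)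
  finally show *: "3 / 4 \<le> 1 - sink_weight d J z" by simp
  have "(\<Sum>j\<in>J. z j / (z j + 2 / 3)) \<le> (\<Sum>j\<in>J. 1)"
    using assms(4) by (intro sum_mono) (fastforce simp: field_simps)
  also have "\<dots> \<le> real d" using assms by simp
  finally have "sink_weight d J z * (\<Sum>j\<in>J. z j / (z j + 2 / 3)) \<le> (5 / 8) ^ d * d"
    using le assms(4) sink_weight_nonneg[OF assms(4)]
    by (intro mult_mono sum_nonneg) (fastforce intro!: divide_nonneg_nonneg)+
  also have "\<dots> = 4 / 3 * d * (5 / 8) ^ d * (3 / 4)" by simp
  also have "\<dots> \<le> 4 / 3 * d * (5 / 8) ^ d * (1 - sink_weight d J z)"
    using * by (intro mult_left_mono) auto
  finally show "sink_weight d J z * (\<Sum>j\<in>J. z j / (z j + 2 / 3)) \<le> 4 / 3 * d * (5 / 8) ^ d * (1 - sink_weight d J z)" .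
qed

text \<open>Along \<open>z j * exp s\<close> all logarithms rise at unit speed, so \<open>c\<close>
  bounds the derivative in \<open>s\<close>, and the path stays above \<open>2 / 15\<close>. The
  constant \<open>A\<close> will be \<open>1 / 3\<close> below the root and 1 at the root.\<close>

lemma ln_sink_weight_increase:
  fixes z :: "'i \<Rightarrow> real"
  assumes "finite J" "0 \<le> E" "\<forall>j\<in>J. 2 / 15 \<le> z j"
    and A: "\<And>w. \<forall>j\<in>J. 2 / 15 \<le> w j \<Longrightarrow> 0 < A - sink_weight d J w"
    and c: "\<And>w. \<forall>j\<in>J. 2 / 15 \<le> w j \<Longrightarrow>
      sink_weight d J w * (\<Sum>j\<in>J. w j / (w j + 2 / 3)) \<le> c * (A - sink_weight d J w)"
  shows "ln (A - sink_weight d J (\<lambda>j. z j * exp E)) \<le> ln (A - sink_weight d J z) + c * E"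
proof -
  define w where "w s j = z j * exp s" for s j
  define f where "f s = ln (A - sink_weight d J (w s)) - c * s" for s
  have w: "\<forall>j\<in>J. 2 / 15 \<le> w s j" if "0 \<le> s" for s
  proof
    fix j assume "j \<in> J"
    then have z: "2 / 15 \<le> z j" using assms by auto
    then have "z j * 1 \<le> z j * exp s" using that by (intro mult_left_mono) auto
    then show "2 / 15 \<le> w s j" using z unfolding w_def by linarith
  qed
  have "f E \<le> f 0"
  proof (rule DERIV_nonpos_imp_nonincreasing[OF assms(2)])
    fix s :: real assume s: "0 \<le> s" "s \<le> E"
    define P where "P = sink_weight d J (w s)"
    define \<Sigma> where "\<Sigma> = (\<Sum>j\<in>J. w s j / (w s j + 2 / 3))"
    have pos: "0 < w t j + 2 / 3" if "j \<in> J" for j t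
    proof -
      have "0 < z j" using assms(3) that by fastforce
      then have "0 < w t j" by (simp add: w_def)
      then show ?thesis by simp
    qed
    have exp_form: "sink_weight d J (w t) = (1 / 2) ^ d * exp (- (\<Sum>j\<in>J. ln (w t j + 2 / 3)))" for t
    proof -
      have "exp (- (\<Sum>j\<in>J. ln (w t j + 2 / 3))) = (\<Prod>j\<in>J. exp (- ln (w t j + 2 / 3)))"
        by (simp add: exp_sum assms(1) flip: sum_negf)
      also have "\<dots> = (\<Prod>j\<in>J. 1 / (w t j + 2 / 3))"
        using pos by (intro prod.cong refl) (simp add: exp_minus inverse_eq_divide)
      finally show ?thesis by (simp add: sink_weight_def)
    qed
    have "((\<lambda>t. (1 / 2) ^ d * exp (- (\<Sum>j\<in>J. ln (w t j + 2 / 3)))) has_real_derivative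
        (1 / 2) ^ d * (exp (- (\<Sum>j\<in>J. ln (w s j + 2 / 3))) * - (\<Sum>j\<in>J. w s j / (w s j + 2 / 3)))) (at s)"
    proof (intro DERIV_cmult DERIV_chain2[OF DERIV_exp] DERIV_minus DERIV_sum)
      fix j assume "j \<in> J"
      then show "((\<lambda>t. ln (w t j + 2 / 3)) has_real_derivative w s j / (w s j + 2 / 3)) (at s)"
        unfolding w_def using pos[of j s]
        by (auto intro!: derivative_eq_intros simp: w_def)
    qed
    then have prod_deriv: "((\<lambda>t. sink_weight d J (w t)) has_real_derivative - P * \<Sigma>) (at s)"
      by (simp add: exp_form P_def \<Sigma>_def mult.assoc)
    have A_pos: "0 < A - P" using A[OF w[OF s(1)]] by (simp add: P_def)
    have "(f has_real_derivative P * \<Sigma> / (A - P) - c) (at s)"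
      unfolding f_def using A_pos
      by (auto intro!: derivative_eq_intros prod_deriv simp: P_def)
    moreover have "P * \<Sigma> / (A - P) - c \<le> 0"
      using c[OF w[OF s(1)]] A_pos by (simp add: P_def \<Sigma>_def field_simps)
    ultimately show "\<exists>y. (f has_real_derivative y) (at s) \<and> y \<le> 0" by blast
  qed
  then show ?thesis by (simp add: f_def w_def[abs_def])
qed

text \<open>The weight decreases in every \<open>z j\<close>, so among the points within distance
  \<open>E\<close> of \<open>w'\<close> the extreme one is \<open>w' j * exp E\<close>. This reduces
  the claim to the scaled path; exchanging the two points gives the absolute value.\<close>

lemma ln_sink_weight_lipschitz:
  fixes z z' :: "'i \<Rightarrow> real"
  assumes "finite J" "\<forall>j\<in>J. 2 / 15 \<le> z j" "\<forall>j\<in>J. 2 / 15 \<le> z' j" "\<forall>j\<in>J. \<bar>ln (z j) - ln (z' j)\<bar> \<le> E" "0 \<le> E"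
    and A: "\<And>w. \<forall>j\<in>J. 2 / 15 \<le> w j \<Longrightarrow> 0 < A - sink_weight d J w"
    and c: "\<And>w. \<forall>j\<in>J. 2 / 15 \<le> w j \<Longrightarrow>
      sink_weight d J w * (\<Sum>j\<in>J. w j / (w j + 2 / 3)) \<le> c * (A - sink_weight d J w)"
  shows "\<bar>ln (A - sink_weight d J z) - ln (A - sink_weight d J z')\<bar> \<le> c * E"
proof -
  have upper: "ln (A - sink_weight d J w) \<le> ln (A - sink_weight d J w') + c * E"
    if w: "\<forall>j\<in>J. 2 / 15 \<le> w j" "\<forall>j\<in>J. 2 / 15 \<le> w' j" "\<forall>j\<in>J. ln (w j) \<le> ln (w' j) + E" for w w' :: "'i \<Rightarrow> real"
  proof -
    have le: "w j \<le> w' j * exp E" if "j \<in> J" for j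
    proof -
      have pos: "0 < w j" "0 < w' j" using w that by fastforce+
      have "exp (ln (w j)) \<le> exp (ln (w' j) + E)" using w that by simp
      then show ?thesis using pos by (simp add: exp_add)
    qed
    have "sink_weight d J (\<lambda>j. w' j * exp E) \<le> sink_weight d J w"
      using le w(1) by (intro sink_weight_antimono) fastforce
    moreover have "0 < A - sink_weight d J w" using A w by blast
    ultimately have "ln (A - sink_weight d J w) \<le> ln (A - sink_weight d J (\<lambda>j. w' j * exp E))" by simp
    also have "\<dots> \<le> ln (A - sink_weight d J w') + c * E"
      using assms(1,5) w(2) A c by (rule ln_sink_weight_increase)
    finally show ?thesis .
  qed
  have "ln (A - sink_weight d J z) \<le> ln (A - sink_weight d J z') + c * E"
    by (rule upper) (use assms(2-4) in fastforce)+
  moreover have "ln (A - sink_weight d J z') \<le> ln (A - sink_weight d J z) + c * E"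
    by (rule upper) (use assms(2-4) in fastforce)+
  ultimately show ?thesis by simp
qed

section \<open>Error of the estimated ratios\<close>

text \<open>These two equations are all that the error analysis takes from orientations;
  \<open>p S\<close> stands for the probability of having no sink in \<open>S\<close>.\<close>

locale sink_free_probability = neighbour_lists L Q for L Q +
  fixes p :: "nat set \<Rightarrow> real"
  assumes p_empty: "p {} = 1"
    and p_insert: "v < length L \<Longrightarrow> v \<notin> S \<Longrightarrow> S \<subseteq> {..<length L} \<Longrightarrow>
      p (insert v S) = p S - (1 / 2) ^ length (L ! v) * p (S - set (L ! v))"
begin

definition ratio :: "nat set \<Rightarrow> nat \<Rightarrow> real" where
  "ratio S v = p (insert v S) / p S"

lemma half_power_mult_le:
  assumes "k \<le> d"
  shows "(1 / 2 :: real) ^ d * (5 / 4) ^ k \<le> (5 / 8) ^ d"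
proof -
  have "(1 / 2 :: real) ^ d * (5 / 4) ^ k \<le> (1 / 2) ^ d * (5 / 4) ^ d"
    using assms by (intro mult_left_mono power_increasing) auto
  then show "(1 / 2 :: real) ^ d * (5 / 4) ^ k \<le> (5 / 8) ^ d" by (simp add: power_mult_distrib[symmetric])
qed

lemma five_eighths_power_le:
  assumes "3 \<le> d"
  shows "(5 / 8 :: real) ^ d \<le> 1 / 4"
proof -
  have "(5 / 8 :: real) ^ d \<le> (5 / 8) ^ 3" using assms by (intro power_decreasing) auto
  then show "(5 / 8 :: real) ^ d \<le> 1 / 4" by (simp add: power3_eq_cube)
qed

lemma card_neighbours_le: "card (S \<inter> set us) \<le> length us"
  using card_mono[of "set us" "S \<inter> set us"] card_length[of us] by simp

text \<open>The two claims need each other. A vertex \<open>u\<close> put back into \<open>S\<close>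
  may have all its neighbours there, and its sink term is at most \<open>1 / 4\<close> of
  \<open>p (S - {u})\<close>; this gives positivity. If \<open>u\<close> is adjacent to some
  \<open>v\<close> outside \<open>S\<close>, the share is at most \<open>1 / 5\<close>, so removing
  \<open>u\<close> multiplies \<open>p\<close> by at most \<open>5 / 4\<close>.\<close>

lemma p_pos_and_growth:
  assumes "S \<subseteq> {..<length L}"
  shows "0 < p S \<and> (\<forall>v us. v < length L \<longrightarrow> v \<notin> S \<longrightarrow> set us \<subseteq> set (L ! v) \<longrightarrow>
    p (S - set us) \<le> (5 / 4) ^ card (S \<inter> set us) * p S)"
  using assms
proof (induction "card S" arbitrary: S rule: less_induct)
  case less
  have fin: "finite S" using less.prems finite_subset by blast
  have removed: "0 < p (S - {u})"
    "v < length L \<Longrightarrow> v \<notin> S - {u} \<Longrightarrow> set us \<subseteq> set (L ! v) \<Longrightarrow>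
      p (S - {u} - set us) \<le> (5 / 4) ^ card ((S - {u}) \<inter> set us) * p (S - {u})"
    if "u \<in> S" for u v us
  proof -
    have "S - {u} \<subseteq> {..<length L}" using less.prems by auto
    note IH = less.hyps[OF card_Diff1_less[OF fin that] this]
    show "0 < p (S - {u})" using IH by blast
    show "v < length L \<Longrightarrow> v \<notin> S - {u} \<Longrightarrow> set us \<subseteq> set (L ! v) \<Longrightarrow>
      p (S - {u} - set us) \<le> (5 / 4) ^ card ((S - {u}) \<inter> set us) * p (S - {u})" using IH by blast
  qed
  have insert_eq: "p S = p (S - {u}) - (1 / 2) ^ length (L ! u) * p (S - {u} - set (L ! u))" if "u \<in> S" for u
    using p_insert[of u "S - {u}"] that less.prems by (auto simp: insert_absorb)
  have pos: "0 < p S"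
  proof (cases "S = {}")
    case False
    then obtain u where u: "u \<in> S" by blast
    then have "u < length L" using less.prems by auto
    have "(1 / 2) ^ length (L ! u) * p (S - {u} - set (L ! u))
        \<le> (1 / 2) ^ length (L ! u) * ((5 / 4) ^ card ((S - {u}) \<inter> set (L ! u)) * p (S - {u}))"
      using removed(2)[OF u, of u "L ! u"] \<open>u < length L\<close> by (intro mult_left_mono) auto
    also have "\<dots> = (1 / 2) ^ length (L ! u) * (5 / 4) ^ card ((S - {u}) \<inter> set (L ! u)) * p (S - {u})" by simp
    also have "\<dots> \<le> (5 / 8) ^ length (L ! u) * p (S - {u})"
      using removed(1)[OF u] card_neighbours_le
      by (intro mult_right_mono half_power_mult_le) auto
    also have "\<dots> \<le> 1 / 4 * p (S - {u})"
      using removed(1)[OF u] degree_ge_3[OF \<open>u < length L\<close>]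
      by (intro mult_right_mono five_eighths_power_le) auto
    finally show ?thesis using insert_eq[OF u] removed(1)[OF u] by simp
  qed (simp add: p_empty)
  have "p (S - set us) \<le> (5 / 4) ^ card (S \<inter> set us) * p S"
    if v: "v < length L" "v \<notin> S" and us: "set us \<subseteq> set (L ! v)" for v us
    using us
  proof (induction us)
    case (Cons u us)
    show ?case
    proof (cases "u \<in> S")
      case False
      then show ?thesis using Cons by simp
    next
      case True
      have u: "u < length L" "v \<in> set (L ! u)" using Cons.prems neighbour_sym[OF v(1)] by auto
      have "(1 / 2) ^ length (L ! u) * p (S - {u} - set (L ! u))
          \<le> (1 / 2) ^ length (L ! u) * ((5 / 4) ^ card ((S - {u}) \<inter> set (L ! u)) * p (S - {u}))"
        using removed(2)[OF True, of u "L ! u"] u by (intro mult_left_mono) auto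
      also have "\<dots> = (1 / 2) ^ length (L ! u) * (5 / 4) ^ card ((S - {u}) \<inter> set (L ! u)) * p (S - {u})" by simp
      also have "\<dots> \<le> 1 / 5 * p (S - {u})"
        using removed(1)[OF True] degree_ge_3[OF u(1)] card_neighbours_less[OF u(2), of "S - {u}"] v
        by (intro mult_right_mono power_five_eighths_le) auto
      finally have step: "p (S - {u}) \<le> 5 / 4 * p S" using insert_eq[OF True] by simp
      have "S \<inter> set (u # us) = insert u ((S - {u}) \<inter> set us)" using True by auto
      then have card: "card (S \<inter> set (u # us)) = Suc (card ((S - {u}) \<inter> set us))" by simp
      have "S - set (u # us) = S - {u} - set us" by auto
      then have "p (S - set (u # us)) \<le> (5 / 4) ^ card ((S - {u}) \<inter> set us) * p (S - {u})"
        using removed(2)[OF True v(1), of us] v Cons.prems by simp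
      also have "\<dots> \<le> (5 / 4) ^ card ((S - {u}) \<inter> set us) * (5 / 4 * p S)"
        using step by (intro mult_left_mono) auto
      finally show ?thesis unfolding card by simp
    qed
  qed simp
  then show ?case using pos by blast
qed

lemma p_pos: "S \<subseteq> {..<length L} \<Longrightarrow> 0 < p S"
  using p_pos_and_growth by blast

lemma p_removed_le:
  "S \<subseteq> {..<length L} \<Longrightarrow> v < length L \<Longrightarrow> v \<notin> S \<Longrightarrow>
    p (S - set (L ! v)) / p S \<le> (5 / 4) ^ card (S \<inter> set (L ! v))"
  using p_pos_and_growth[of S] by (auto simp: field_simps)

lemma ratio_eq:
  assumes "S \<subseteq> {..<length L}" "v < length L" "v \<notin> S"
  shows "ratio S v = 1 - (1 / 2) ^ length (L ! v) * (p (S - set (L ! v)) / p S)"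
  using p_insert[OF assms(2,3,1)] p_pos[OF assms(1)] by (simp add: ratio_def field_simps)

lemma ratio_bounds:
  assumes "S \<subseteq> {..<length L}" "v < length L" "v \<notin> S" "w \<in> set (L ! v)" "w \<notin> S"
  shows "4 / 5 \<le> ratio S v" "ratio S v \<le> 1"
    "ratio S v \<ge> 1 - (1 / 2) ^ length (L ! v) * (5 / 4) ^ (length (L ! v) - 1)"
proof -
  define k where "k = card (S \<inter> set (L ! v))"
  have k: "k \<le> length (L ! v) - 1" using card_neighbours_less[OF assms(4,5)] by (simp add: k_def)
  define t where "t = (1 / 2) ^ length (L ! v) * (p (S - set (L ! v)) / p S)"
  have "t \<le> (1 / 2) ^ length (L ! v) * (5 / 4) ^ k"
    unfolding t_def using p_removed_le[OF assms(1-3)] by (intro mult_left_mono) (auto simp: k_def)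
  moreover have "(1 / 2 :: real) ^ length (L ! v) * (5 / 4) ^ k \<le> 1 / 5"
    using k degree_ge_3[OF assms(2)] by (intro power_five_eighths_le)
  moreover have "(1 / 2 :: real) ^ length (L ! v) * (5 / 4) ^ k \<le> (1 / 2) ^ length (L ! v) * (5 / 4) ^ (length (L ! v) - 1)"
    using k by (intro mult_left_mono power_increasing) auto
  moreover have "0 \<le> t"
    unfolding t_def using p_pos[OF assms(1)] p_pos[of "S - set (L ! v)"] assms(1)
    by (intro mult_nonneg_nonneg divide_nonneg_nonneg) (auto intro: less_imp_le)
  moreover have "ratio S v = 1 - t" unfolding t_def by (rule ratio_eq[OF assms(1-3)])
  ultimately show "4 / 5 \<le> ratio S v" "ratio S v \<le> 1"
    "ratio S v \<ge> 1 - (1 / 2) ^ length (L ! v) * (5 / 4) ^ (length (L ! v) - 1)"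
    by linarith+
qed

text \<open>The pairs in \<open>rs\<close> are the estimated and the exact ratios met along the scan.\<close>

lemma scan_factors:
  assumes "v < length L" "v \<notin> S" "set us \<subseteq> set (L ! v)" "S \<subseteq> {..<length L}" "0 \<le> x"
    and "\<And>u S'. u \<in> set us \<Longrightarrow> u \<in> S \<Longrightarrow> S' \<subseteq> S - {u} \<Longrightarrow>
      \<bar>ln (ratio_estimate N S' u / Q - 2 / 3) - ln (ratio S' u - 2 / 3)\<bar> \<le> E"
  obtains rs :: "(real \<times> real) list" where
    "length rs = card (S \<inter> set us)"
    "\<forall>(a, b)\<in>set rs. 4 / 5 \<le> a \<and> 4 / 5 \<le> b \<and> \<bar>ln (a - 2 / 3) - ln (b - 2 / 3)\<bar> \<le> E"
    "p (S - set us) / p S = prod_list (map (\<lambda>(a, b). 1 / b) rs)"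
    "scan N S us x \<le> x * ((1 / 2) ^ length us * prod_list (map (\<lambda>(a, b). 1 / a) rs))"
    "x * ((1 / 2) ^ length us * prod_list (map (\<lambda>(a, b). 1 / a) rs)) \<le> scan N S us x + 8 / 3"
proof -
  \<comment> \<open>A division loses at most 1, and every later entry multiplies this loss by at
    most \<open>5 / 8\<close>; the geometric series sums to \<open>8 / 3\<close>. The invariants
    with \<open>(5 / 8) ^ length us\<close> keep track of its partial sums.\<close>
  have "\<exists>rs :: (real \<times> real) list. length rs = card (S \<inter> set us) \<and>
    (\<forall>(a, b)\<in>set rs. 4 / 5 \<le> a \<and> 4 / 5 \<le> b \<and> \<bar>ln (a - 2 / 3) - ln (b - 2 / 3)\<bar> \<le> E) \<and>
    p (S - set us) / p S = prod_list (map (\<lambda>(a, b). 1 / b) rs) \<and>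
    0 \<le> prod_list (map (\<lambda>(a, b). 1 / a) rs) \<and>
    (1 / 2) ^ length us * prod_list (map (\<lambda>(a, b). 1 / a) rs) \<le> (5 / 8) ^ length us \<and>
    scan N S us x \<le> x * ((1 / 2) ^ length us * prod_list (map (\<lambda>(a, b). 1 / a) rs)) \<and>
    x * ((1 / 2) ^ length us * prod_list (map (\<lambda>(a, b). 1 / a) rs)) \<le> scan N S us x + 8 / 3 * (1 - (5 / 8) ^ length us)"
    using assms(2-6)
  proof (induction us arbitrary: S x)
    case Nil
    then show ?case using p_pos[of S] by (intro exI[of _ "[]"]) auto
  next
    case (Cons u us)
    have u: "u < length L" "v \<in> set (L ! u)" using Cons.prems neighbour_sym[OF assms(1)] by auto
    have round: "real_of_int (m div k) \<le> m / k" "m / k - 1 \<le> real_of_int (m div k)" for m k :: int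
      using real_of_int_div4[of m k] real_of_int_div3[of m k] by auto
    have combine: "scan N S' us x' \<le> x * (c * C) \<and>
        x * (c * C) \<le> scan N S' us x' + 8 / 3 * (1 - (5 / 8) ^ length (u # us))"
      if "scan N S' us x' \<le> x' * C" "x' * C \<le> scan N S' us x' + 8 / 3 * (1 - (5 / 8) ^ length us)"
        "0 \<le> C" "C \<le> (5 / 8) ^ length us" "real_of_int x' \<le> x * c" "x * c - 1 \<le> x'" for S' x' and c C :: real
    proof
      have "x' * C \<le> x * c * C" using that by (intro mult_right_mono)
      then show "scan N S' us x' \<le> x * (c * C)" using that(1) by (simp add: mult.assoc)
      have "(x * c - x') * C \<le> 1 * C" using that by (intro mult_right_mono) auto
      then have le: "x * (c * C) \<le> x' * C + C" by (simp add: algebra_simps)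
      show "x * (c * C) \<le> scan N S' us x' + 8 / 3 * (1 - (5 / 8) ^ length (u # us))"
      proof -
        define g where "g = (5 / 8 :: real) ^ length us"
        have "(5 / 8 :: real) ^ length (u # us) = 5 / 8 * g" by (simp add: g_def)
        moreover note that(2,4) le
        ultimately show ?thesis unfolding g_def[symmetric] by argo
      qed
    qed
    show ?case
    proof (cases "u \<in> S")
      case False
      have sets: "S \<inter> set (u # us) = S \<inter> set us" "S - set (u # us) = S - set us" using False by auto
      obtain rs :: "(real \<times> real) list" where rs: "length rs = card (S \<inter> set us)"
        "\<forall>(a, b)\<in>set rs. 4 / 5 \<le> a \<and> 4 / 5 \<le> b \<and> \<bar>ln (a - 2 / 3) - ln (b - 2 / 3)\<bar> \<le> E"
        "p (S - set us) / p S = prod_list (map (\<lambda>(a, b). 1 / b) rs)"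
        "0 \<le> prod_list (map (\<lambda>(a, b). 1 / a) rs)"
        "(1 / 2) ^ length us * prod_list (map (\<lambda>(a, b). 1 / a) rs) \<le> (5 / 8) ^ length us"
        "scan N S us (x div 2) \<le> (x div 2) * ((1 / 2) ^ length us * prod_list (map (\<lambda>(a, b). 1 / a) rs))"
        "(x div 2) * ((1 / 2) ^ length us * prod_list (map (\<lambda>(a, b). 1 / a) rs))
          \<le> scan N S us (x div 2) + 8 / 3 * (1 - (5 / 8) ^ length us)"
        using Cons.IH[of S "x div 2"] Cons.prems by auto
      have *: "scan N S (u # us) x = scan N S us (x div 2)" using False u by (simp add: scan_Cons)
      have "scan N S us (x div 2) \<le> x * (1 / 2 * ((1 / 2) ^ length us * prod_list (map (\<lambda>(a, b). 1 / a) rs))) \<and>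
        x * (1 / 2 * ((1 / 2) ^ length us * prod_list (map (\<lambda>(a, b). 1 / a) rs)))
          \<le> scan N S us (x div 2) + 8 / 3 * (1 - (5 / 8) ^ length (u # us))"
        using rs round[of x 2] by (intro combine) auto
      moreover have "1 / 2 * ((1 / 2) ^ length us * prod_list (map (\<lambda>(a, b). 1 / a) rs)) \<le> 5 / 8 * (5 / 8) ^ length us"
        using rs by (intro mult_mono) auto
      ultimately show ?thesis using rs unfolding * sets
        by (intro exI[of _ rs]) (auto simp: mult.assoc)
    next
      case True
      define a where "a = ratio_estimate N (S - {u}) u / Q"
      define b where "b = ratio (S - {u}) u"
      define x' where "x' = x * Q div (2 * ratio_estimate N (S - {u}) u)"
      have a: "4 / 5 \<le> a"
        using ratio_estimate_bounds(1)[of u v "S - {u}" N] u Cons.prems(1) Q_pos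
        by (simp add: a_def field_simps flip: of_int_mult)
      have b: "4 / 5 \<le> b" unfolding b_def
        by (rule ratio_bounds[of "S - {u}" u v]) (use u Cons.prems in auto)
      have close: "\<bar>ln (a - 2 / 3) - ln (b - 2 / 3)\<bar> \<le> E"
        unfolding a_def b_def using Cons.prems(5)[of u "S - {u}"] True by simp
      have est_pos: "0 < ratio_estimate N (S - {u}) u" using a Q_pos
        by (auto simp: a_def field_simps zero_less_mult_iff simp flip: of_int_mult)
      have c: "x * Q / (2 * ratio_estimate N (S - {u}) u) = x * (1 / 2 * (1 / a))"
        using Q_pos by (simp add: a_def)
      have x': "0 \<le> x'" "real_of_int x' \<le> x * (1 / 2 * (1 / a))" "x * (1 / 2 * (1 / a)) - 1 \<le> x'"
        using round[of "x * Q" "2 * ratio_estimate N (S - {u}) u"] c Cons.prems(4) est_pos Q_pos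
        by (auto simp: x'_def pos_imp_zdiv_nonneg_iff)
      have "S \<inter> set (u # us) = insert u ((S - {u}) \<inter> set us)" using True by auto
      then have card: "card (S \<inter> set (u # us)) = Suc (card ((S - {u}) \<inter> set us))" by simp
      have set_eq: "S - set (u # us) = S - {u} - set us" by auto
      obtain rs :: "(real \<times> real) list" where rs: "length rs = card ((S - {u}) \<inter> set us)"
        "\<forall>(a, b)\<in>set rs. 4 / 5 \<le> a \<and> 4 / 5 \<le> b \<and> \<bar>ln (a - 2 / 3) - ln (b - 2 / 3)\<bar> \<le> E"
        "p (S - {u} - set us) / p (S - {u}) = prod_list (map (\<lambda>(a, b). 1 / b) rs)"
        "0 \<le> prod_list (map (\<lambda>(a, b). 1 / a) rs)"
        "(1 / 2) ^ length us * prod_list (map (\<lambda>(a, b). 1 / a) rs) \<le> (5 / 8) ^ length us"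
        "scan N (S - {u}) us x' \<le> x' * ((1 / 2) ^ length us * prod_list (map (\<lambda>(a, b). 1 / a) rs))"
        "x' * ((1 / 2) ^ length us * prod_list (map (\<lambda>(a, b). 1 / a) rs))
          \<le> scan N (S - {u}) us x' + 8 / 3 * (1 - (5 / 8) ^ length us)"
      proof -
        have sub: "v \<notin> S - {u}" "set us \<subseteq> set (L ! v)" "S - {u} \<subseteq> {..<length L}"
          using Cons.prems(1-3) by auto
        have "\<bar>ln (ratio_estimate N S' w / Q - 2 / 3) - ln (ratio S' w - 2 / 3)\<bar> \<le> E"
          if "w \<in> set us" "w \<in> S - {u}" "S' \<subseteq> S - {u} - {w}" for w S'
          using that by (intro Cons.prems(5)) auto
        from Cons.IH[OF sub x'(1) this] show thesis using that by blast
      qed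
      define A where "A = prod_list (map (\<lambda>(a, b). 1 / a) rs)"
      have eq: "scan N S (u # us) x = scan N (S - {u}) us x'" using True u by (simp add: scan_Cons x'_def)
      have final: "scan N (S - {u}) us x' \<le> x * (1 / 2 * (1 / a) * ((1 / 2) ^ length us * A)) \<and>
        x * (1 / 2 * (1 / a) * ((1 / 2) ^ length us * A))
          \<le> scan N (S - {u}) us x' + 8 / 3 * (1 - (5 / 8) ^ length (u # us))"
        using rs x' by (intro combine) (auto simp: A_def)
      have "S - {u} \<subseteq> {..<length L}" using Cons.prems(3) by auto
      note pos = p_pos[OF this] p_pos[OF Cons.prems(3)]
      have "insert u (S - {u}) = S" using True by auto
      then have "p (S - set (u # us)) / p S = 1 / b * (p (S - {u} - set us) / p (S - {u}))"
        using pos unfolding set_eq by (simp add: b_def ratio_def)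
      moreover have "1 / 2 * (1 / a) * ((1 / 2) ^ length us * A) \<le> 5 / 8 * (5 / 8) ^ length us"
        using a rs by (intro mult_mono) (auto simp: A_def field_simps)
      moreover have "0 \<le> 1 / a * A" using a rs by (auto simp: A_def)
      ultimately show ?thesis
        using rs a b close final unfolding eq card
        by (intro exI[of _ "(a, b) # rs"]) (auto simp: A_def mult_ac)
    qed
  qed
  then obtain rs :: "(real \<times> real) list" where rs: "length rs = card (S \<inter> set us)"
    "\<forall>(a, b)\<in>set rs. 4 / 5 \<le> a \<and> 4 / 5 \<le> b \<and> \<bar>ln (a - 2 / 3) - ln (b - 2 / 3)\<bar> \<le> E"
    "p (S - set us) / p S = prod_list (map (\<lambda>(a, b). 1 / b) rs)"
    "scan N S us x \<le> x * ((1 / 2) ^ length us * prod_list (map (\<lambda>(a, b). 1 / a) rs))"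
    "x * ((1 / 2) ^ length us * prod_list (map (\<lambda>(a, b). 1 / a) rs)) \<le> scan N S us x + 8 / 3 * (1 - (5 / 8) ^ length us)"
    by blast
  moreover have "8 / 3 * (1 - (5 / 8 :: real) ^ length us) \<le> 8 / 3" by simp
  ultimately show thesis by (intro that[of rs]) (assumption | linarith)+
qed

end

section \<open>Propagation of errors through the recursion\<close>

context sink_free_probability begin

text \<open>Two errors add up: that of the children, passed on with constant \<open>c\<close>, and a
  rounding error of at most \<open>8 / 3 / Q\<close>, which the logarithm magnifies by at most
  \<open>1 / \<delta>\<close> because its argument is at least \<open>\<delta>\<close>.\<close>

lemma scan_error:
  assumes "v < length L" "v \<notin> S" "S \<subseteq> {..<length L}" "0 \<le> E" "0 < \<delta>"
    and children: "\<And>u S'. u \<in> set (L ! v) \<Longrightarrow> u \<in> S \<Longrightarrow> S' \<subseteq> S - {u} \<Longrightarrow>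
      \<bar>ln (ratio_estimate N S' u / Q - 2 / 3) - ln (ratio S' u - 2 / 3)\<bar> \<le> E"
    and J: "J = {..<card (S \<inter> set (L ! v))}"
    and A: "\<And>w. \<forall>j\<in>J. 2 / 15 \<le> w j \<Longrightarrow> \<delta> \<le> A - sink_weight (length (L ! v)) J w"
    and c: "\<And>w. \<forall>j\<in>J. 2 / 15 \<le> w j \<Longrightarrow>
      sink_weight (length (L ! v)) J w * (\<Sum>j\<in>J. w j / (w j + 2 / 3))
        \<le> c * (A - sink_weight (length (L ! v)) J w)"
  shows "\<bar>ln (A - scan N S (L ! v) Q / Q) - ln (A - (1 - ratio S v))\<bar> \<le> c * E + 8 / 3 / \<delta> / Q"
proof -
  define d where "d = length (L ! v)"
  obtain rs :: "(real \<times> real) list" where rs: "length rs = card (S \<inter> set (L ! v))"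
    "\<forall>(a, b)\<in>set rs. 4 / 5 \<le> a \<and> 4 / 5 \<le> b \<and> \<bar>ln (a - 2 / 3) - ln (b - 2 / 3)\<bar> \<le> E"
    "p (S - set (L ! v)) / p S = prod_list (map (\<lambda>(a, b). 1 / b) rs)"
    "scan N S (L ! v) Q \<le> Q * ((1 / 2) ^ d * prod_list (map (\<lambda>(a, b). 1 / a) rs))"
    "Q * ((1 / 2) ^ d * prod_list (map (\<lambda>(a, b). 1 / a) rs)) \<le> scan N S (L ! v) Q + 8 / 3"
    using scan_factors[of v S "L ! v" Q N E] assms Q_pos by (auto simp: d_def)
  define z where "z j = fst (rs ! j) - 2 / 3" for j
  define z' where "z' j = snd (rs ! j) - 2 / 3" for j
  have rs_nth: "4 / 5 \<le> fst (rs ! j) \<and> 4 / 5 \<le> snd (rs ! j) \<and>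
      \<bar>ln (fst (rs ! j) - 2 / 3) - ln (snd (rs ! j) - 2 / 3)\<bar> \<le> E" if "j \<in> J" for j
  proof -
    have "rs ! j \<in> set rs" using that rs(1) J by simp
    from bspec[OF rs(2) this] show ?thesis by (simp add: case_prod_beta)
  qed
  have z: "\<forall>j\<in>J. 2 / 15 \<le> z j" "\<forall>j\<in>J. 2 / 15 \<le> z' j" "\<forall>j\<in>J. \<bar>ln (z j) - ln (z' j)\<bar> \<le> E"
    using rs_nth by (fastforce simp: z_def z'_def)+
  have lists: "prod_list (map (\<lambda>(a, b). 1 / a) rs) = (\<Prod>j\<in>J. 1 / fst (rs ! j))"
    "prod_list (map (\<lambda>(a, b). 1 / b) rs) = (\<Prod>j\<in>J. 1 / snd (rs ! j))"
    unfolding prod.list_conv_set_nth J rs(1)[symmetric]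
    by (auto simp: atLeast0LessThan case_prod_beta intro!: prod.cong)
  have weights: "(1 / 2) ^ d * prod_list (map (\<lambda>(a, b). 1 / a) rs) = sink_weight d J z"
    "(1 / 2) ^ d * prod_list (map (\<lambda>(a, b). 1 / b) rs) = sink_weight d J z'"
    unfolding lists sink_weight_def z_def z'_def by simp_all
  have exact: "A - (1 - ratio S v) = A - sink_weight d J z'"
    using ratio_eq[OF assms(3,1,2)] rs(3) weights(2) by (simp add: d_def)
  define \<eta> where "\<eta> = sink_weight d J z - scan N S (L ! v) Q / Q"
  have "scan N S (L ! v) Q / Q \<le> sink_weight d J z"
    using rs(4) Q_pos unfolding weights by (simp add: pos_divide_le_eq mult.commute)
  moreover have "sink_weight d J z \<le> (scan N S (L ! v) Q + 8 / 3) / Q"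
    using rs(5) Q_pos unfolding weights by (subst pos_le_divide_eq) (simp_all add: mult.commute)
  ultimately have "0 \<le> \<eta>" "\<eta> \<le> 8 / 3 / Q"
    unfolding \<eta>_def add_divide_distrib by linarith+
  moreover define X where "X = A - sink_weight d J z"
  have X: "\<delta> \<le> X" using A[OF z(1)] by (simp add: X_def d_def)
  ultimately have "ln X \<le> ln (X + \<eta>)" "ln (X + \<eta>) - ln X \<le> \<eta> / X"
    using assms(5) ln_diff_le[of "X + \<eta>" X] by auto
  moreover have "\<eta> / X \<le> 8 / 3 / \<delta> / Q"
  proof -
    have "\<eta> / X \<le> 8 / 3 / Q / \<delta>"
      using X assms(5) Q_pos \<open>0 \<le> \<eta>\<close> \<open>\<eta> \<le> 8 / 3 / Q\<close> by (intro frac_le) auto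
    then show ?thesis by (simp add: mult_ac)
  qed
  moreover have "\<bar>ln X - ln (A - sink_weight d J z')\<bar> \<le> c * E"
    unfolding X_def
  proof (rule ln_sink_weight_lipschitz)
    show "finite J" using J by simp
    show "\<And>w. \<forall>j\<in>J. 2 / 15 \<le> w j \<Longrightarrow> 0 < A - sink_weight d J w"
      using A assms(5) by (force simp: d_def)
  qed (use z assms(4) c in \<open>auto simp: d_def\<close>)
  ultimately have "\<bar>ln (X + \<eta>) - ln (A - sink_weight d J z')\<bar> \<le> c * E + 8 / 3 / \<delta> / Q" by linarith
  moreover have "A - scan N S (L ! v) Q / Q = X + \<eta>" by (simp add: X_def \<eta>_def)
  ultimately show ?thesis unfolding exact by simp
qed

text \<open>Both terms survive the recursion. A level adds a rounding error of
  \<open>8 / 3 / (2 / 15) = 20\<close> over \<open>Q\<close>, and \<open>D \<ge> 2\<close> at least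
  halves what is inherited, so 40 is preserved. The 10 stems from the leaves, where the error is at
  most \<open>15 / 2\<close> times the sink term and the latter at most
  \<open>4 / 3 / (N + 4)\<close>.\<close>

lemma ratio_estimate_error:
  assumes "v < length L" "v \<notin> S" "S \<subseteq> {..<length L}" "w \<in> set (L ! v)" "w \<notin> S"
  shows "\<bar>ln (ratio_estimate N S v / Q - 2 / 3) - ln (ratio S v - 2 / 3)\<bar> \<le> 10 / (N + 4) + 40 / Q"
  using assms
proof (induction N arbitrary: v S w rule: less_induct)
  case (less N)
  define D where "D = length (L ! v) - 1"
  have D: "2 \<le> D" "length (L ! v) = Suc D" using degree_ge_3[OF less.prems(1)] by (auto simp: D_def)
  show ?case
  proof (cases "N < length (L ! v)")
    case True
    define P where "P = 1 - ratio S v"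
    have P_le: "P \<le> 1 / 5" "0 \<le> P" using ratio_bounds(1,2)[of S v w] less.prems by (auto simp: P_def)
    have "P \<le> (1 / 2) ^ Suc D * (5 / 4) ^ D"
      using ratio_bounds(3)[of S v w] less.prems D by (simp add: P_def)
    also have "\<dots> = 1 / 2 * (5 / 8) ^ D" by (simp add: power_mult_distrib[symmetric])
    finally have "P * (D + 4) \<le> 1 / 2 * (5 / 8) ^ D * (D + 4)" by (intro mult_right_mono) auto
    also have "\<dots> = 1 / 2 * ((5 / 8) ^ D * (D + 4))" by simp
    also have "\<dots> \<le> 1 / 2 * (8 / 3)"
      using five_eighths_power_bounds(2)[OF D(1)] by (intro mult_left_mono) auto
    finally have "P * (D + 4) \<le> 4 / 3" by simp
    moreover have "P * (real N + 4) \<le> P * (D + 4)" using True D P_le by (intro mult_left_mono) auto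
    ultimately have P: "P * (real N + 4) \<le> 4 / 3" by linarith
    have "ln (1 / 3) - ln (1 / 3 - P) \<le> P / (1 / 3 - P)"
      using ln_diff_le[of "1 / 3" "1 / 3 - P"] P_le by simp
    also have "\<dots> \<le> P / (2 / 15)" using P_le by (intro divide_left_mono) auto
    also have "\<dots> \<le> 10 / (real N + 4)" using P by (simp add: field_simps)
    also have "\<dots> \<le> 10 / (real N + 4) + 40 / Q" using Q_pos by simp
    finally have upper: "ln (1 / 3) - ln (1 / 3 - P) \<le> 10 / (real N + 4) + 40 / Q" .
    have lower: "ln (1 / 3 - P) \<le> ln (1 / 3)" using P_le by (subst ln_le_cancel_iff) auto
    have eq: "ratio_estimate N S v / Q - 2 / 3 = 1 / 3" "ratio S v - 2 / 3 = 1 / 3 - P"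
      using True Q_pos by (simp_all add: ratio_estimate_def P_def)
    show ?thesis unfolding eq using upper lower by linarith
  next
    case False
    define N' where "N' = child_budget N v"
    define E where "E = 10 / (real N' + 4) + 40 / Q"
    have N': "N' < N" using False less.prems by (auto simp: N'_def intro: child_budget_less)
    have card: "card (S \<inter> set (L ! v)) \<le> D"
      using card_neighbours_less[OF less.prems(4,5)] by (simp add: D_def)
    have "\<bar>ln (1 / 3 - scan N' S (L ! v) Q / Q) - ln (1 / 3 - (1 - ratio S v))\<bar>
        \<le> 1 / D * E + 8 / 3 / (2 / 15) / Q"
    proof (rule scan_error[OF _ _ _ _ _ _ refl])
      fix u S' assume u: "u \<in> set (L ! v)" "u \<in> S" "S' \<subseteq> S - {u}"
      show "\<bar>ln (ratio_estimate N' S' u / Q - 2 / 3) - ln (ratio S' u - 2 / 3)\<bar> \<le> E"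
        unfolding E_def
        by (rule less.IH[OF N', where w = v]) (use u less.prems neighbour_sym[of v u] in auto)
    next
      fix w :: "nat \<Rightarrow> real" assume w: "\<forall>j\<in>{..<card (S \<inter> set (L ! v))}. 2 / 15 \<le> w j"
      show "2 / 15 \<le> 1 / 3 - sink_weight (length (L ! v)) {..<card (S \<inter> set (L ! v))} w"
        unfolding D(2) by (rule sink_weight_contracts) (use D card w in auto)
      show "sink_weight (length (L ! v)) {..<card (S \<inter> set (L ! v))} w *
          (\<Sum>j\<in>{..<card (S \<inter> set (L ! v))}. w j / (w j + 2 / 3))
        \<le> 1 / D * (1 / 3 - sink_weight (length (L ! v)) {..<card (S \<inter> set (L ! v))} w)"
        unfolding D(2) by (rule sink_weight_contracts) (use D card w in auto)
    qed (use less.prems Q_pos in \<open>auto simp: E_def\<close>)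
    moreover have "1 / D * E + 8 / 3 / (2 / 15) / Q \<le> 10 / (real N + 4) + 40 / Q"
    proof -
      have "N - Suc D < (N' + 1) * D"
        using D dividend_less_div_times[of D "N - Suc D"] by (simp add: N'_def child_budget_def)
      moreover have "4 \<le> 2 * D" using D by simp
      ultimately have "N + 4 \<le> D * (N' + 4)" using False D by (simp add: algebra_simps)
      then have "real (N + 4) \<le> real (D * (N' + 4))" by (rule of_nat_mono)
      then have "10 / (D * (real N' + 4)) \<le> 10 / (real N + 4)" using D by (intro divide_left_mono) auto
      moreover have "40 / (D * real_of_int Q) \<le> 40 / (2 * real_of_int Q)"
        using D Q_pos by (intro divide_left_mono mult_right_mono) auto
      moreover have "1 / D * E = 10 / (D * (real N' + 4)) + 40 / (D * real_of_int Q)"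
        by (simp add: E_def distrib_left)
      ultimately show ?thesis by simp
    qed
    moreover have "ratio_estimate N S v / Q - 2 / 3 = 1 / 3 - scan N' S (L ! v) Q / Q"
      using False Q_pos by (simp add: ratio_estimate_def N'_def diff_divide_distrib)
    ultimately show ?thesis by simp
  qed
qed

text \<open>The children have error at most \<open>30 * D / Q\<close>, and
  \<open>(5 / 8) ^ d * (D * d) \<le> 2\<close> brings their contribution down to
  \<open>80 / Q\<close>; the other \<open>14 / Q\<close> cover the rounding error
  \<open>32 / 9 / Q\<close>.\<close>

lemma root_estimate_error:
  assumes "v < length L" "v \<notin> S" "S \<subseteq> {..<length L}" "int N = Q"
  shows "\<bar>ln (ratio_estimate N S v / Q) - ln (ratio S v)\<bar> \<le> 94 / Q"
proof -
  define d where "d = length (L ! v)"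
  define D where "D = d - 1"
  have d: "3 \<le> d" "d = Suc D" "2 \<le> D" using degree_ge_3[OF assms(1)] by (auto simp: d_def D_def)
  have D_bound: "(5 / 8) ^ d * (D * d) \<le> 2"
    using five_eighths_power_bounds(3)[OF d(3)] by (simp add: d(2) algebra_simps)
  have "2 * d \<le> D * d" using d(3) by (rule mult_le_mono1)
  then have le: "real (2 * d) \<le> real (D * d)" by (rule of_nat_mono)
  have "2 * ((5 / 8 :: real) ^ d * d) = (5 / 8) ^ d * real (2 * d)" by simp
  also have "\<dots> \<le> (5 / 8) ^ d * real (D * d)"
    using le by (rule mult_left_mono) simp
  also have "\<dots> \<le> 2" using D_bound by simp
  finally have d_bound: "(5 / 8) ^ d * d \<le> 1" by simp
  show ?thesis
  proof (cases "N < d")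
    case True
    define P where "P = 1 - ratio S v"
    define q where "q = p (S - set (L ! v)) / p S"
    have q: "0 \<le> q" "q \<le> (5 / 4) ^ card (S \<inter> set (L ! v))"
    proof -
      have "S - set (L ! v) \<subseteq> {..<length L}" using assms(3) by blast
      then show "0 \<le> q" using p_pos[OF assms(3)] p_pos unfolding q_def by (simp add: less_imp_le)
      show "q \<le> (5 / 4) ^ card (S \<inter> set (L ! v))" unfolding q_def by (rule p_removed_le[OF assms(3,1,2)])
    qed
    have P_eq: "P = (1 / 2) ^ d * q" unfolding P_def q_def d_def using ratio_eq[OF assms(3,1,2)] by simp
    also have "\<dots> \<le> (1 / 2) ^ d * (5 / 4) ^ card (S \<inter> set (L ! v))" using q by (intro mult_left_mono) auto
    also have "\<dots> \<le> (5 / 8) ^ d" using d(1) card_neighbours_le by (intro half_power_mult_le) (auto simp: d_def)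
    finally have P: "P \<le> (5 / 8) ^ d" .
    moreover have "(5 / 8 :: real) ^ d \<le> 1 / 4" by (rule five_eighths_power_le[OF d(1)])
    ultimately have P_le: "P \<le> 1 / 4" by simp
    have P_ge: "0 \<le> P" using q P_eq by simp
    have "P * N \<le> (5 / 8) ^ d * d" using P P_ge True by (intro mult_mono) auto
    then have PN: "P * N \<le> 1" using d_bound by simp
    have "ln 1 - ln (1 - P) \<le> P / (1 - P)" using ln_diff_le[of 1 "1 - P"] P_le by simp
    also have "\<dots> \<le> P / (3 / 4)" using P_le P_ge by (intro divide_left_mono) auto
    also have "\<dots> \<le> 94 / real N" using PN assms(4) Q_pos by (auto simp: field_simps)
    also have "real N = real_of_int Q" using assms(4) by (metis of_int_of_nat_eq)
    finally have upper: "ln 1 - ln (1 - P) \<le> 94 / Q" .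
    have lower: "ln (1 - P) \<le> ln 1" using P_le P_ge by (subst ln_le_cancel_iff) auto
    have eq: "ratio_estimate N S v / Q = 1" "ratio S v = 1 - P"
      using True Q_pos by (simp_all add: ratio_estimate_def P_def d_def)
    show ?thesis unfolding eq using upper lower by linarith
  next
    case False
    define N' where "N' = child_budget N v"
    define E where "E = 10 / (real N' + 4) + 40 / Q"
    define c where "c = 4 / 3 * d * (5 / 8) ^ d"
    have card: "card (S \<inter> set (L ! v)) \<le> d" using card_neighbours_le by (simp add: d_def)
    have "\<bar>ln (1 - scan N' S (L ! v) Q / Q) - ln (1 - (1 - ratio S v))\<bar> \<le> c * E + 8 / 3 / (3 / 4) / Q"
    proof (rule scan_error[OF _ _ _ _ _ _ refl])
      fix u S' assume u: "u \<in> set (L ! v)" "u \<in> S" "S' \<subseteq> S - {u}"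
      show "\<bar>ln (ratio_estimate N' S' u / Q - 2 / 3) - ln (ratio S' u - 2 / 3)\<bar> \<le> E"
        unfolding E_def
        by (rule ratio_estimate_error[where w = v]) (use u assms neighbour_sym[of v u] in auto)
    next
      fix w :: "nat \<Rightarrow> real" assume w: "\<forall>j\<in>{..<card (S \<inter> set (L ! v))}. 2 / 15 \<le> w j"
      show "3 / 4 \<le> 1 - sink_weight (length (L ! v)) {..<card (S \<inter> set (L ! v))} w"
        unfolding d_def[symmetric] by (rule sink_weight_root) (use d card w in auto)
      show "sink_weight (length (L ! v)) {..<card (S \<inter> set (L ! v))} w *
          (\<Sum>j\<in>{..<card (S \<inter> set (L ! v))}. w j / (w j + 2 / 3))
        \<le> c * (1 - sink_weight (length (L ! v)) {..<card (S \<inter> set (L ! v))} w)"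
        unfolding d_def[symmetric] c_def by (rule sink_weight_root) (use d card w in auto)
    qed (use assms Q_pos in \<open>auto simp: E_def\<close>)
    moreover have "c * E + 8 / 3 / (3 / 4) / Q \<le> 94 / Q"
    proof -
      have "N - d < (N' + 1) * D"
        using d dividend_less_div_times[of D "N - d"] by (simp add: N'_def child_budget_def d_def[symmetric])
      then have "N \<le> D * (N' + 4)" using False d by (simp add: algebra_simps)
      then have "real N \<le> real (D * (N' + 4))" by (rule of_nat_mono)
      moreover have N_eq: "real N = real_of_int Q" using assms(4) by (metis of_int_of_nat_eq)
      ultimately have Q_le: "real_of_int Q \<le> D * (real N' + 4)" by simp
      have "10 / (real N' + 4) \<le> 10 * D / Q"
        using Q_le Q_pos by (simp add: field_simps)
      moreover have "40 / real_of_int Q \<le> 20 * D / Q"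
        using d Q_pos by (intro divide_right_mono) auto
      ultimately have "E \<le> 30 * D / Q" unfolding E_def by (simp add: add_divide_distrib[symmetric])
      moreover have "0 \<le> c" by (simp add: c_def)
      ultimately have "c * E \<le> c * (30 * D / Q)" by (intro mult_left_mono)
      also have "\<dots> = 40 * ((5 / 8) ^ d * (D * d)) / Q" by (simp add: c_def)
      also have "\<dots> \<le> 40 * 2 / Q" using D_bound Q_pos by (intro divide_right_mono mult_left_mono) auto
      finally have "c * E \<le> 80 / Q" by simp
      moreover have "8 / 3 / (3 / 4) / real_of_int Q \<le> 14 / Q" using Q_pos by (simp add: field_simps)
      ultimately show ?thesis using Q_pos by (simp add: field_simps)
    qed
    moreover have "ratio_estimate N S v / Q = 1 - scan N' S (L ! v) Q / Q"
      using False Q_pos by (simp add: ratio_estimate_def N'_def d_def diff_divide_distrib)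
    ultimately show ?thesis by simp
  qed
qed

end

section \<open>Error of the product\<close>

context sink_free_probability begin

text \<open>Each vertex contributes \<open>94 / Q\<close> from its ratio and \<open>2 / Q\<close>
  from rounding the mantissa, which is at least \<open>Q / 2\<close> even before it is
  renormalised.\<close>

lemma product_error:
  assumes Q: "Q = 2 ^ \<tau>" "0 < \<tau>" and "v \<le> length L"
  shows "\<bar>ln (fst (product (- int \<tau>) v) * 2 powi snd (product (- int \<tau>) v)) - ln (p {..<v})\<bar> \<le> v * (96 / Q)"
  using assms(3)
proof (induction v)
  case 0
  have "real_of_int Q * 2 powi (- int \<tau>) = 1" using Q(1) by (simp add: power_int_minus)
  then show ?case by (simp add: p_empty)
next
  case (Suc v)
  have Q_even: "even Q" using Q by simp
  define a where "a = fst (product (- int \<tau>) v)"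
  define e where "e = snd (product (- int \<tau>) v)"
  define r where "r = ratio_estimate (nat Q) {..<v} v"
  define y where "y = real_of_int (a * r) / Q"
  define a' where "a' = a * r div Q"
  have v: "v < length L" using Suc.prems by simp
  have a: "Q \<le> a" using product_bounds(1)[OF Q_even, of v] Suc.prems by (simp add: a_def)
  have a'_ge: "Q \<le> 2 * a'"
    using product_bounds(1)[OF Q_even, of "Suc v" "- int \<tau>"] Suc.prems Q_pos
    by (auto simp: Let_def a'_def a_def r_def split: if_splits)
  have r: "3 * Q \<le> 4 * r" unfolding r_def using root_estimate_bounds(1)[OF v, of "{..<v}"] by simp
  have pos: "0 < a" "0 < a'" "0 < r" using a a'_ge r Q_pos by linarith+
  have le: "real_of_int a' \<le> y" "y - 1 \<le> a'"
    using real_of_int_div4[of "a * r" Q] real_of_int_div3[of "a * r" Q] by (auto simp: y_def a'_def)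
  have y_pos: "0 < y" using le(1) pos by linarith
  have "ln y - ln a' \<le> (y - a') / a'" using ln_diff_le[OF y_pos, of a'] pos by simp
  also have "\<dots> \<le> 1 / (Q / 2)" using le a'_ge Q_pos by (intro frac_le) auto
  finally have round_le: "ln y - ln a' \<le> 2 / Q" by simp
  have round_ge: "ln a' \<le> ln y" using le pos y_pos by simp
  have y: "ln y = ln a + ln (r / Q)"
    using pos Q_pos by (simp add: y_def ln_mult ln_div)
  have value_eq: "fst (product (- int \<tau>) (Suc v)) * 2 powi snd (product (- int \<tau>) (Suc v)) = real_of_int a' * 2 powi e"
    by (simp add: Let_def a'_def a_def r_def e_def power_int_diff)
  have "ln (real_of_int a' * 2 powi e) = ln a' + ln (2 powi e)"
    using pos by (simp add: ln_mult)
  moreover have "ln (real_of_int a * 2 powi e) = ln a + ln (2 powi e)"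
    using pos by (simp add: ln_mult)
  moreover have "ln (p {..<Suc v}) = ln (p {..<v}) + ln (ratio {..<v} v)"
  proof -
    have "{..<v} \<subseteq> {..<length L}" "{..<Suc v} \<subseteq> {..<length L}" using v by auto
    then have "0 < p {..<v}" "0 < p {..<Suc v}" by (auto intro: p_pos)
    moreover have "p {..<Suc v} = p {..<v} * ratio {..<v} v"
      using calculation by (simp add: ratio_def lessThan_Suc)
    ultimately show ?thesis by (simp add: ln_mult ln_div ratio_def lessThan_Suc)
  qed
  moreover have "\<bar>ln (r / Q) - ln (ratio {..<v} v)\<bar> \<le> 94 / Q"
    unfolding r_def by (rule root_estimate_error) (use v Q_pos in auto)
  moreover have "\<bar>ln (real_of_int a * 2 powi e) - ln (p {..<v})\<bar> \<le> v * (96 / Q)"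
    using Suc by (simp add: a_def e_def)
  moreover have "real (Suc v) * (96 / Q) = v * (96 / Q) + 94 / Q + 2 / Q"
    by (simp add: algebra_simps add_divide_distrib)
  ultimately show ?case unfolding value_eq using round_le round_ge y by linarith
qed

end

lemma exp_half_bounds:
  fixes \<epsilon> y :: real
  assumes "0 < \<epsilon>" "\<epsilon> < 1" "\<bar>y\<bar> \<le> \<epsilon> / 2"
  shows "1 - \<epsilon> \<le> exp y" "exp y \<le> 1 + \<epsilon>"
proof -
  show "1 - \<epsilon> \<le> exp y" using exp_ge_add_one_self[of y] assms by linarith
  have "exp y \<le> 1 + 2 * \<bar>y\<bar>" using exp_bound_lemma[of y] assms by simp
  then show "exp y \<le> 1 + \<epsilon>" using assms by linarith
qed

section \<open>Sinks of random orientations\<close>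

locale adjacency_listed_multigraph =
  fixes G :: "(nat, 'e) multigraph" and L :: "nat list list"
  assumes wf: "wf_multigraph G" and adj: "adjacency_list G L"
begin

definition incident :: "nat \<Rightarrow> 'e set" where
  "incident v = {e \<in> edges G. v \<in> ends G e}"

definition sink_free_on :: "nat set \<Rightarrow> ('e \<Rightarrow> nat) set" where
  "sink_free_on S = {\<sigma> \<in> orientations G. \<forall>v\<in>S. \<not> is_sink G \<sigma> v}"

lemma verts_eq: "verts G = {..<length L}"
  using adj by (simp add: adjacency_list_def)

lemma finite_edges: "finite (edges G)" and ends: "e \<in> edges G \<Longrightarrow> ends G e \<subseteq> {..<length L}"
  "e \<in> edges G \<Longrightarrow> card (ends G e) = 2"
  using wf verts_eq by (auto simp: wf_multigraph_def)

lemma ends_eqI: "e \<in> edges G \<Longrightarrow> v \<in> ends G e \<Longrightarrow> w \<in> ends G e \<Longrightarrow> v \<noteq> w \<Longrightarrow> ends G e = {v, w}"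
  using ends(2)[of e] by (auto simp: card_2_iff)

lemma neighbour_iff:
  assumes "v < length L"
  shows "w \<in> set (L ! v) \<longleftrightarrow> (\<exists>e\<in>edges G. ends G e = {v, w})"
proof -
  have "w \<in> set (L ! v) \<longleftrightarrow> count_list (L ! v) w \<noteq> 0" by (simp add: count_list_0_iff)
  also have "\<dots> \<longleftrightarrow> card {e \<in> edges G. ends G e = {v, w}} \<noteq> 0"
    using adj assms by (simp add: adjacency_list_def)
  also have "\<dots> \<longleftrightarrow> (\<exists>e\<in>edges G. ends G e = {v, w})" using finite_edges by auto
  finally show ?thesis .
qed

lemma neighbour_valid:
  assumes "v < length L" "w \<in> set (L ! v)"
  shows "w < length L" "v \<in> set (L ! w)" "w \<noteq> v"
proof -
  obtain e where e: "e \<in> edges G" "ends G e = {v, w}" using neighbour_iff assms by blast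
  then show w: "w < length L" using ends(1)[of e] by auto
  show "v \<in> set (L ! w)" unfolding neighbour_iff[OF w] using e by (auto simp: insert_commute)
  show "w \<noteq> v" using ends(2)[OF e(1)] e(2) by auto
qed

lemma length_eq_degree:
  assumes "v < length L"
  shows "length (L ! v) = card (incident v)"
proof -
  have "length (L ! v) = (\<Sum>w<length L. count_list (L ! v) w)"
    using neighbour_valid[OF assms] by (intro sum_count_set[symmetric]) auto
  also have "\<dots> = (\<Sum>w<length L. card {e \<in> edges G. ends G e = {v, w}})"
    using adj assms by (simp add: adjacency_list_def)
  also have "\<dots> = card (\<Union>w<length L. {e \<in> edges G. ends G e = {v, w}})"
    using finite_edges by (intro card_UN_disjoint[symmetric]) (auto simp: doubleton_eq_iff)
  also have "(\<Union>w<length L. {e \<in> edges G. ends G e = {v, w}}) = incident v"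
  proof (intro equalityI subsetI)
    fix e assume "e \<in> incident v"
    then have e: "e \<in> edges G" "v \<in> ends G e" by (auto simp: incident_def)
    obtain w where "w \<in> ends G e" "w \<noteq> v" using ends(2)[OF e(1)] by (auto simp: card_2_iff)
    then have "ends G e = {v, w}" "w < length L" using ends_eqI[OF e] ends(1)[OF e(1)] by auto
    then show "e \<in> (\<Union>w<length L. {e \<in> edges G. ends G e = {v, w}})" using e by auto
  qed (auto simp: incident_def)
  finally show ?thesis .
qed

lemma sum_length_eq: "(\<Sum>v<length L. length (L ! v)) = 2 * card (edges G)"
proof -
  have "(\<Sum>v<length L. length (L ! v)) = (\<Sum>v<length L. \<Sum>e\<in>edges G. of_bool (v \<in> ends G e))"
    using finite_edges by (intro sum.cong refl) (simp add: length_eq_degree incident_def Int_def)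
  also have "\<dots> = (\<Sum>e\<in>edges G. \<Sum>v<length L. of_bool (v \<in> ends G e))" by (rule sum.swap)
  also have "\<dots> = (\<Sum>e\<in>edges G. 2)"
  proof (intro sum.cong refl)
    fix e assume e: "e \<in> edges G"
    have "{..<length L} \<inter> ends G e = ends G e" using ends(1)[OF e] by auto
    then show "(\<Sum>v<length L. of_bool (v \<in> ends G e)) = (2 :: nat)" using ends(2)[OF e] by simp
  qed
  finally show ?thesis by simp
qed

lemma finite_orientations: "finite (orientations G)"
  unfolding orientations_def using finite_edges ends(2)
  by (intro finite_PiE) (auto intro: card_ge_0_finite)

lemma card_orientations_on:
  assumes "A \<subseteq> edges G"
  shows "card (\<Pi>\<^sub>E e\<in>A. ends G e) = 2 ^ card A"
proof -
  have "finite A" using assms finite_edges finite_subset by blast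
  then have "card (\<Pi>\<^sub>E e\<in>A. ends G e) = (\<Prod>e\<in>A. card (ends G e))" by (rule card_PiE)
  also have "\<dots> = (\<Prod>e\<in>A. 2)" using assms ends(2) by (intro prod.cong) auto
  finally show ?thesis by simp
qed

text \<open>At a sink \<open>v\<close> all edges are oriented inwards, so its neighbours are automatically no sinks;
  reorienting the edges at \<open>v\<close> arbitrarily affects only \<open>v\<close> and its neighbours.\<close>

lemma card_sink_times:
  assumes "v < length L" "v \<notin> S" "S \<subseteq> {..<length L}"
  shows "card {\<sigma> \<in> sink_free_on S. is_sink G \<sigma> v} * 2 ^ length (L ! v) = card (sink_free_on (S - set (L ! v)))"
proof -
  define A where "A = {\<sigma> \<in> sink_free_on S. is_sink G \<sigma> v}"
  define I where "I = (\<Pi>\<^sub>E e\<in>incident v. ends G e)"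
  define merge where "merge = (\<lambda>(\<sigma>, \<tau>) e. if e \<in> incident v then \<tau> e else \<sigma> e :: nat)"
  have inc: "incident v \<subseteq> edges G" by (auto simp: incident_def)
  have in_edge: "\<sigma> e = v" if "\<sigma> \<in> A" "e \<in> incident v" for \<sigma> e
    using that by (auto simp: A_def is_sink_def outgoing_def incident_def)
  have not_incident: "e \<notin> incident v" if "w \<in> S - set (L ! v)" "e \<in> edges G" "w \<in> ends G e" for w e
  proof
    assume "e \<in> incident v"
    then have "v \<in> ends G e" by (simp add: incident_def)
    moreover have "v \<noteq> w" using that(1) assms(2) by auto
    ultimately have "ends G e = {v, w}" using ends_eqI that by auto
    then have "w \<in> set (L ! v)" unfolding neighbour_iff[OF assms(1)] using that(2) by auto
    then show False using that by auto
  qed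
  have outgoing_cong: "outgoing G \<sigma> w = outgoing G \<tau> w"
    if "w \<in> S - set (L ! v)" "\<And>e. e \<notin> incident v \<Longrightarrow> \<sigma> e = \<tau> e" for \<sigma> \<tau> w
    unfolding outgoing_def
  proof (intro Collect_cong conj_cong refl)
    fix e assume "e \<in> edges G" "w \<in> ends G e"
    then have "\<sigma> e = \<tau> e" using not_incident[OF that(1)] that(2) by blast
    then show "\<sigma> e \<noteq> w \<longleftrightarrow> \<tau> e \<noteq> w" by simp
  qed
  \<comment> \<open>In \<open>A\<close> the orientation is forced on the edges at \<open>v\<close>,
    so overwriting them by a free choice loses no information.\<close>
  have "bij_betw merge (A \<times> I) (sink_free_on (S - set (L ! v)))"
    unfolding bij_betw_def
  proof
    show "inj_on merge (A \<times> I)"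
    proof (rule inj_onI, clarify)
      fix \<sigma> \<tau> \<sigma>' \<tau>'
      assume *: "\<sigma> \<in> A" "\<tau> \<in> I" "\<sigma>' \<in> A" "\<tau>' \<in> I" and eq: "merge (\<sigma>, \<tau>) = merge (\<sigma>', \<tau>')"
      have "\<sigma> e = \<sigma>' e" for e
        using fun_cong[OF eq, of e] in_edge[OF *(1), of e] in_edge[OF *(3), of e]
        by (cases "e \<in> incident v") (auto simp: merge_def)
      moreover have "\<tau> e = \<tau>' e" for e
        using fun_cong[OF eq, of e] *(2,4)
        by (cases "e \<in> incident v") (auto simp: merge_def I_def PiE_def extensional_def)
      ultimately show "\<sigma> = \<sigma>' \<and> \<tau> = \<tau>'" by auto
    qed
    show "merge ` (A \<times> I) = sink_free_on (S - set (L ! v))"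
    proof (intro equalityI subsetI)
      fix \<rho> assume "\<rho> \<in> merge ` (A \<times> I)"
      then obtain \<sigma> \<tau> where st: "\<sigma> \<in> A" "\<tau> \<in> I" "\<rho> = merge (\<sigma>, \<tau>)" by auto
      have "\<rho> \<in> orientations G"
        using st inc by (auto simp: merge_def A_def I_def sink_free_on_def orientations_def PiE_def extensional_def Pi_def)
      moreover have "outgoing G \<rho> w = outgoing G \<sigma> w" if "w \<in> S - set (L ! v)" for w
        using that by (rule outgoing_cong) (simp add: st merge_def)
      ultimately show "\<rho> \<in> sink_free_on (S - set (L ! v))"
        using st by (auto simp: sink_free_on_def A_def is_sink_def)
    next
      fix \<rho> assume \<rho>: "\<rho> \<in> sink_free_on (S - set (L ! v))"
      define \<sigma> where "\<sigma> e = (if e \<in> incident v then v else \<rho> e)" for e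
      define \<tau> where "\<tau> = restrict \<rho> (incident v)"
      have "\<sigma> \<in> orientations G"
        using \<rho> inc by (auto simp: \<sigma>_def sink_free_on_def orientations_def PiE_def extensional_def Pi_def incident_def)
      moreover have "is_sink G \<sigma> v" by (auto simp: is_sink_def outgoing_def \<sigma>_def incident_def)
      moreover have "\<not> is_sink G \<sigma> w" if "w \<in> S" for w
      proof (cases "w \<in> set (L ! v)")
        case True
        then obtain e where e: "e \<in> edges G" "ends G e = {v, w}" using neighbour_iff assms by blast
        then have "e \<in> outgoing G \<sigma> w" using that assms(2) by (auto simp: outgoing_def \<sigma>_def incident_def)
        then show ?thesis by (auto simp: is_sink_def)
      next
        case False
        then have "outgoing G \<sigma> w = outgoing G \<rho> w" using that by (intro outgoing_cong) (auto simp: \<sigma>_def)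
        then show ?thesis using \<rho> that False by (auto simp: is_sink_def sink_free_on_def)
      qed
      ultimately have "\<sigma> \<in> A" by (simp add: A_def sink_free_on_def)
      moreover have "\<tau> \<in> I"
        using \<rho> inc by (auto simp: \<tau>_def I_def sink_free_on_def orientations_def PiE_def Pi_def)
      moreover have "\<rho> = merge (\<sigma>, \<tau>)" by (auto simp: merge_def \<sigma>_def \<tau>_def)
      ultimately show "\<rho> \<in> merge ` (A \<times> I)" by blast
    qed
  qed
  then have "card (A \<times> I) = card (sink_free_on (S - set (L ! v)))" by (rule bij_betw_same_card)
  then show ?thesis
    using card_orientations_on[OF inc] length_eq_degree[OF assms(1)]
    by (simp add: card_cartesian_product A_def I_def)
qed

definition sink_free_prob :: "nat set \<Rightarrow> real" where
  "sink_free_prob S = card (sink_free_on S) / 2 ^ card (edges G)"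

lemma sink_free_prob_empty: "sink_free_prob {} = 1"
  using card_orientations_on[of "edges G"]
  by (simp add: sink_free_prob_def sink_free_on_def orientations_def)

lemma sink_free_prob_insert:
  assumes "v < length L" "v \<notin> S" "S \<subseteq> {..<length L}"
  shows "sink_free_prob (insert v S) =
    sink_free_prob S - (1 / 2) ^ length (L ! v) * sink_free_prob (S - set (L ! v))"
proof -
  define A where "A = {\<sigma> \<in> sink_free_on S. is_sink G \<sigma> v}"
  have "sink_free_on S = sink_free_on (insert v S) \<union> A" "sink_free_on (insert v S) \<inter> A = {}"
    by (auto simp: sink_free_on_def A_def)
  moreover have "finite (sink_free_on S)" using finite_orientations by (simp add: sink_free_on_def)
  ultimately have "card (sink_free_on S) = card (sink_free_on (insert v S)) + card A"
    by (metis card_Un_disjoint finite_Un)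
  moreover have "real (card A) * 2 ^ length (L ! v) = card (sink_free_on (S - set (L ! v)))"
    unfolding card_sink_times[OF assms, symmetric] A_def by simp
  ultimately show ?thesis
    by (simp add: sink_free_prob_def field_simps power_divide)
qed

lemma sink_free_orientations_eq:
  "real (card (sink_free_orientations G)) = 2 ^ card (edges G) * sink_free_prob {..<length L}"
  by (simp add: sink_free_prob_def sink_free_on_def sink_free_orientations_def verts_eq)

end

section \<open>Error, running time and word length combined\<close>

lemma uses_words_below_mono: "uses_words_below P L \<epsilon> B \<Longrightarrow> B \<le> B' \<Longrightarrow> uses_words_below P L \<epsilon> B'"
  unfolding uses_words_below_def by (fastforce intro: order_trans)

theorem theorem1p3:
  "\<exists>(P :: com) (C :: real) (k :: nat).
     \<forall>(G :: (nat, nat) multigraph) (L :: nat list list) (\<epsilon> :: real).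
       wf_multigraph G \<and> verts G \<noteq> {} \<and> (\<forall>v\<in>verts G. 3 \<le> vertex_degree G v) \<and>
       adjacency_list G L \<and> 0 < \<epsilon> \<and> \<epsilon> < 1 \<longrightarrow>
       (let n = real (card (verts G)); m = real (card (edges G)) in
        (\<exists>T :: nat. real T \<le> C * ((n / \<epsilon>)\<^sup>2 * ln (n / \<epsilon>)) \<and>
           halts_within P L \<epsilon> T \<and>
           measure_pmf.prob (run P L \<epsilon> T)
             {s. is_approximation \<epsilon> (real (card (sink_free_orientations G))) (output_value s)} \<ge> 3 / 4) \<and>
        uses_words_below P L \<epsilon> ((m + n / \<epsilon>) ^ k))"
proof (rule exI[of _ count_program], rule exI[of _ 204800], rule exI[of _ 7], intro allI impI, elim conjE)
  fix G :: "(nat, nat) multigraph" and L :: "nat list list" and \<epsilon> :: real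
  assume G: "wf_multigraph G" "verts G \<noteq> {}" "\<forall>v\<in>verts G. 3 \<le> vertex_degree G v"
    and L: "adjacency_list G L" and \<epsilon>: "0 < \<epsilon>" "\<epsilon> < 1"
  interpret adjacency_listed_multigraph G L by unfold_locales (fact G L)+
  define n where "n = length L"
  define m where "m = card (edges G)"
  define x where "x = n / \<epsilon>"
  have deg: "3 \<le> length (L ! v)" if "v < length L" for v
    using G(3) that by (simp add: length_eq_degree incident_def vertex_degree_def verts_eq)
  have n: "2 \<le> n"
  proof -
    have 0: "0 < length L" using G(2) by (auto simp: verts_eq)
    then obtain w where "w \<in> set (L ! 0)" using deg[of 0] by (cases "L ! 0") auto
    then show ?thesis using neighbour_valid[OF 0] by (force simp: n_def)
  qed
  have m: "3 \<le> m"
  proof -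
    have "(\<Sum>v<length L. 3) \<le> (\<Sum>v<length L. length (L ! v))" using deg by (intro sum_mono) auto
    then show ?thesis using n unfolding sum_length_eq by (simp add: n_def m_def)
  qed
  have n_le_x: "n \<le> x" using \<epsilon> by (simp add: x_def pos_le_divide_eq mult_left_le)
  then have x: "2 \<le> x" using n by linarith
  define \<tau> where "\<tau> = (LEAST \<tau>. 256 * real n < \<epsilon> * 2 ^ \<tau>)"
  have "\<exists>\<tau>. 256 * real n / \<epsilon> < 2 ^ \<tau>" by (rule real_arch_pow) simp
  then have "\<exists>\<tau>. 256 * real n < \<epsilon> * 2 ^ \<tau>" using \<epsilon> by (simp add: field_simps)
  then have \<tau>: "256 * real n < \<epsilon> * 2 ^ \<tau>" unfolding \<tau>_def by (rule LeastI_ex)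
  have \<tau>_least: "\<not> 256 * real n < \<epsilon> * 2 ^ j" if "j < \<tau>" for j
    using that unfolding \<tau>_def by (rule not_less_Least)
  have \<tau>_pos: "0 < \<tau>"
  proof (rule ccontr)
    assume "\<not> 0 < \<tau>"
    then show False using \<tau> n \<epsilon> by simp
  qed
  define Q :: int where "Q = 2 ^ \<tau>"
  have Q_real: "real_of_int Q = 2 ^ \<tau>" by (simp add: Q_def)
  have Q_ge: "2 \<le> Q" using self_le_power[of "2::int" \<tau>] \<tau>_pos by (simp add: Q_def)
  have Q_le: "real_of_int Q \<le> 512 * x"
  proof -
    have "\<epsilon> * 2 ^ (\<tau> - 1) \<le> 256 * real n" using \<tau>_least[of "\<tau> - 1"] \<tau>_pos by simp
    moreover have "(2 :: real) ^ \<tau> = 2 * 2 ^ (\<tau> - 1)" using \<tau>_pos by (cases \<tau>) auto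
    ultimately show ?thesis using \<epsilon> by (simp add: Q_real x_def field_simps)
  qed
  define B :: int where "B = 4 * Q + int n + 4 * int m"
  interpret sink_free_probability L Q sink_free_prob
  proof
    show "0 < Q" using Q_ge by simp
  qed (fact deg sink_free_prob_empty | rule sink_free_prob_insert, assumption+ | blast dest: neighbour_valid)+
  interpret traversal L \<epsilon> B Q
    by unfold_locales (use Q_ge in \<open>auto simp: B_def n_def\<close>)
  define val where "val = fst (product (- int \<tau>) n) * 2 powi snd (product (- int \<tau>) n)"
  have "wp count_program (\<lambda>R M t. R 0 = fst (product (- int \<tau>) n) \<and>
    R 1 = snd (product (- int \<tau>) n) + int m \<and> t \<le> 6 * \<tau> + n * (140 * nat Q + 90) + 12) (\<lambda>_. 0) (\<lambda>_. 0) 0"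
  proof -
    have "2 * Q + int (length L) + 2 * int (\<Sum>w<length L. length (L ! w)) \<le> B"
      using Q_ge unfolding sum_length_eq by (simp add: B_def n_def m_def)
    from wp_count_program[OF \<tau>[unfolded n_def] \<tau>_least[unfolded n_def] Q_def \<tau>_pos this]
    show ?thesis unfolding sum_length_eq by (simp add: n_def m_def)
  qed
  then obtain R M t where run: "run count_program L \<epsilon> t = return_pmf ([], R, M)"
    and R: "R 0 = fst (product (- int \<tau>) n)" "R 1 = snd (product (- int \<tau>) n) + int m"
    and t: "t \<le> 6 * \<tau> + n * (140 * nat Q + 90) + 12"
    and words: "uses_words_below count_program L \<epsilon> (real_of_int B)"
    by (rule run_wp) (use Q_ge in \<open>auto simp: B_def\<close>)
  have "real t \<le> 204800 * (x\<^sup>2 * ln x)"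
  proof -
    have "\<tau> < 2 ^ \<tau>" by (rule less_exp)
    then have "real \<tau> \<le> Q" using Q_real by (metis less_imp_le of_nat_less_iff of_nat_numeral of_nat_power)
    have "real t \<le> real (6 * \<tau> + n * (140 * nat Q + 90) + 12)" using t by (rule of_nat_mono)
    also have "\<dots> = 6 * \<tau> + real n * (140 * Q + 90) + 12" using Q_ge by simp
    also have "\<dots> \<le> 6 * Q + 140 * (real n * Q) + 90 * n + 12"
      using \<open>real \<tau> \<le> Q\<close> by (simp add: algebra_simps)
    also have "\<dots> \<le> 200 * (real n * Q)"
    proof -
      have "2 * real_of_int Q \<le> real n * Q" using n Q_ge by (intro mult_right_mono) auto
      moreover have "real n * 2 \<le> real n * Q" using n Q_ge by (intro mult_left_mono) auto
      ultimately show ?thesis using n by linarith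
    qed
    also have "real n * Q \<le> x * (512 * x)" using n_le_x Q_le Q_ge x by (intro mult_mono) auto
    also have "200 * (x * (512 * x)) = 204800 * (x\<^sup>2 * (1 / 2))" by (simp add: power2_eq_square)
    \<comment> \<open>From \<open>x \<ge> 2\<close>; this accounts for the last factor in
      \<open>204800 = 200 * 512 * 2\<close>.\<close>
    also have "1 / 2 \<le> ln x"
    proof -
      have "ln 2 \<le> ln x" using x by simp
      then show ?thesis using ln2_ge_two_thirds by linarith
    qed
    finally show ?thesis by (simp add: mult_left_mono)
  qed
  moreover have "halts_within count_program L \<epsilon> t" by (simp add: halts_within_def run)
  moreover have "is_approximation \<epsilon> (real (card (sink_free_orientations G))) (output_value ([], R, M))"
  proof -
    define p where "p = sink_free_prob {..<n}"
    have p: "0 < p" unfolding p_def by (rule p_pos) (simp add: n_def)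
    have "Q \<le> fst (product (- int \<tau>) n)" using product_bounds(1)[of n] \<tau>_pos by (simp add: Q_def n_def)
    then have val: "0 < val" using Q_ge by (simp add: val_def)
    have "\<bar>ln val - ln p\<bar> \<le> n * (96 / Q)"
      unfolding val_def p_def by (rule product_error[OF Q_def \<tau>_pos]) (simp add: n_def)
    \<comment> \<open>It takes \<open>192 * n \<le> \<epsilon> * Q\<close>, which the stopping test
      \<open>256 * n < \<epsilon> * Q\<close> provides.\<close>
    also have "\<dots> \<le> \<epsilon> / 2" using \<tau> Q_real Q_ge by (simp add: field_simps)
    finally have "1 - \<epsilon> \<le> exp (ln val - ln p)" "exp (ln val - ln p) \<le> 1 + \<epsilon>"
      using exp_half_bounds[OF \<epsilon>] by blast+
    moreover have "exp (ln val - ln p) = val / p" using p val by (simp add: exp_diff)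
    moreover have "output_value ([], R, M) = 2 ^ m * val" 
      unfolding output_value.simps R val_def by (simp add: power_int_add)
    moreover have "real (card (sink_free_orientations G)) = 2 ^ m * p"
      using sink_free_orientations_eq by (simp add: m_def p_def n_def)
    ultimately show ?thesis by (simp add: is_approximation_def)
  qed
  moreover have "uses_words_below count_program L \<epsilon> ((real m + x) ^ 7)"
  proof (rule uses_words_below_mono[OF words])
    have "real_of_int B = 4 * Q + n + 4 * m" by (simp add: B_def)
    \<comment> \<open>The coefficient of \<open>x\<close> is at most
      \<open>4 * 512 + 1 = 2049\<close>. From \<open>m \<ge> 3\<close> and \<open>x \<ge> 2\<close>
      follows \<open>m + x \<ge> 5\<close>, so six factors \<open>m + x\<close> absorb it.\<close>
    also have "\<dots> \<le> 5 ^ 6 * (m + x)" using Q_le n_le_x x by simp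
    also have "\<dots> \<le> (m + x) ^ 6 * (m + x)" using m x by (intro mult_right_mono power_mono) auto
    finally show "real_of_int B \<le> (real m + x) ^ 7" by (simp add: eval_nat_numeral mult_ac)
  qed
  ultimately show "let n = real (card (verts G)); m = real (card (edges G)) in
        (\<exists>T :: nat. real T \<le> 204800 * ((n / \<epsilon>)\<^sup>2 * ln (n / \<epsilon>)) \<and>
           halts_within count_program L \<epsilon> T \<and>
           measure_pmf.prob (run count_program L \<epsilon> T)
             {s. is_approximation \<epsilon> (real (card (sink_free_orientations G))) (output_value s)} \<ge> 3 / 4) \<and>
        uses_words_below count_program L \<epsilon> ((m + n / \<epsilon>) ^ 7)"
    by (auto simp: Let_def run measure_return_pmf verts_eq x_def n_def m_def intro!: exI[of _ t])
qed

end
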